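(* Let $q\in(-1,1)$, let $\mathcal{H}$ be a real separable Hilbert space, and let $\mathcal{H}_+$ be a real Hilbert space which is densely embedded into $\mathcal{H}$ and satisfies $\|\cdot\|_{\mathcal{H}}\le\|\cdot\|_{\mathcal{H}_+}$ (possibly $\mathcal{H}_+=\mathcal{H}$). Let $\alpha\ge1$ and define $$\mathcal{G}_q(\mathcal{H}_+,\alpha):=\operatorname{proj\,lim}_{r\ge1}\mathcal{G}_q(\mathcal{H}_+,r,\alpha).$$ Then $\mathcal{G}_q(\mathcal{H}_+,\alpha)$ is densely and continuously embedded into the $q$-Fock space $\mathcal{F}_q(\mathcal{H})$ and is an algebra under the addition and the tensor multiplication $\otimes$. Furthermore, for any $s>r\ge1$ there exists $C_1>0$ such that $$\|F\otimes G\|_{\mathcal{G}_q(\mathcal{H}_+,r,\alpha)}\le C_1\,\|F\|_{\mathcal{G}_q(\mathcal{H}_+,s,\alpha)}\,\|G\|_{\mathcal{G}_q(\mathcal{H}_+,s,\alpha)}$$ for any $F,G\in\mathcal{G}_q(\mathcal{H}_+,\alpha)$.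
   Context: Notation. $[n]_q:=1+q+\dots+q^{n-1}$, $[n]_q!:=[1]_q[2]_q\cdots[n]_q$, $[0]_q!:=1$; convention $0^0:=1$. For a real Hilbert space $\mathcal{K}$ and $c>0$, $\mathcal{K}c$ denotes the Hilbert space equal to $\mathcal{K}$ as a set with scalar product $c(\cdot,\cdot)_{\mathcal{K}}$. Here $\mathcal{K}^{\otimes n}$ is the Hilbert space tensor power, $\mathcal{K}^{\otimes 0}:=\mathbb{R}$. $q$-Fock space. For $n\in\mathbb{N}$ let $P_q^{(n)}$ be the bounded linear operator on $\mathcal{H}^{\otimes n}$ given by $P_q^{(n)}f_1\otimes\dots\otimes f_n:=\sum_{\pi\in S_n}q^{\operatorname{inv}(\pi)}f_{\pi(1)}\otimes\dots\otimes f_{\pi(n)}$, where $\operatorname{inv}(\pi)$ is the number of pairs $i<j$ with $\pi(i)>\pi(j)$; this operator is strictly positive. $\mathcal{F}_q^{(n)}(\mathcal{H})$ is $\mathcal{H}^{\otimes n}$ as a set, with scalar product $(f,g)_{\mathcal{F}_q^{(n)}(\mathcal{H})}:=(P_q^{(n)}f,g)_{\mathcal{H}^{\otimes n}}$; $\mathcal{F}_q^{(0)}(\mathcal{H}):=\mathbb{R}$; and $\mathcal{F}_q(\mathcal{H}):=\bigoplus_{n=0}^\infty\mathcal{F}_q^{(n)}(\mathcal{H})$ (Hilbert space direct sum). Spaces $\mathcal{G}_q$. For a real separable Hilbert space $\mathcal{K}$, $r>0$, $\alpha\ge1$: $\mathcal{G}_q(\mathcal{K},r,\alpha):=\bigoplus_{n=0}^\infty\mathcal{K}^{\otimes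 n}\,r^n([n]_q!)^\alpha$ (Hilbert space direct sum), i.e. $\|F\|^2_{\mathcal{G}_q(\mathcal{K},r,\alpha)}=\sum_n\|f^{(n)}\|^2_{\mathcal{K}^{\otimes n}}r^n([n]_q!)^\alpha$ for $F=(f^{(n)})_{n\ge0}$. The projective limit over $r\ge1$ is the intersection of these Hilbert spaces with the projective limit topology. Tensor multiplication: for $F=(f^{(n)})_{n\ge0}$ and $G=(g^{(n)})_{n\ge0}$, $F\otimes G:=\big(\sum_{i=0}^nf^{(i)}\otimes g^{(n-i)}\big)_{n\ge0}$. *)

theory Defs
  imports "HOL-Analysis.Analysis" "HOL-Combinatorics.Permutations"
begin

section \<open>The Hilbert space of square-summable real functions\<close>

typedef 'i ell2 = "{f :: 'i \<Rightarrow> real. (\<lambda>i. (f i)\<^sup>2) summable_on UNIV}"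
  morphisms ell2_apply Abs_ell2
  by (rule exI[of _ "\<lambda>_. 0"]) simp

setup_lifting type_definition_ell2

lemma ell2_square: "(\<lambda>i. (ell2_apply x i)\<^sup>2) summable_on UNIV"
  using ell2_apply by blast

lemma ell2_eqI: "(\<And>i. ell2_apply x i = ell2_apply y i) \<Longrightarrow> x = y"
  by (metis ell2_apply_inject ext)

lemma square_summable_mult:
  fixes f g :: "'i \<Rightarrow> real"
  assumes "(\<lambda>i. (f i)\<^sup>2) summable_on A" and "(\<lambda>i. (g i)\<^sup>2) summable_on A"
  shows "(\<lambda>i. f i * g i) summable_on A"
proof -
  have "(\<lambda>i. \<bar>f i * g i\<bar>) summable_on A"
  proof (rule summable_on_comparison_test)
    show "(\<lambda>i. (f i)\<^sup>2 + (g i)\<^sup>2) summable_on A"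
      using assms by (rule summable_on_add)
    show "\<bar>f i * g i\<bar> \<le> (f i)\<^sup>2 + (g i)\<^sup>2" for i
    proof -
      have "2 * (\<bar>f i\<bar> * \<bar>g i\<bar>) \<le> (f i)\<^sup>2 + (g i)\<^sup>2"
        using sum_squares_bound[of "\<bar>f i\<bar>" "\<bar>g i\<bar>"] by simp
      moreover have "0 \<le> \<bar>f i\<bar> * \<bar>g i\<bar>" by simp
      ultimately show ?thesis unfolding abs_mult by linarith
    qed
  qed simp
  then show ?thesis
    using summable_on_iff_abs_summable_on_real by fastforce
qed

lemma square_summable_add:
  fixes f g :: "'i \<Rightarrow> real"
  assumes "(\<lambda>i. (f i)\<^sup>2) summable_on A" and "(\<lambda>i. (g i)\<^sup>2) summable_on A"
  shows "(\<lambda>i. (f i + g i)\<^sup>2) summable_on A"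
proof -
  have "(\<lambda>i. (f i)\<^sup>2 + (g i)\<^sup>2 + 2 * (f i * g i)) summable_on A"
    by (intro summable_on_add assms summable_on_cmult_right square_summable_mult)
  then show ?thesis by (simp add: power2_sum mult.assoc)
qed

lemma square_summable_cmult:
  fixes f :: "'i \<Rightarrow> real"
  assumes "(\<lambda>i. (f i)\<^sup>2) summable_on A"
  shows "(\<lambda>i. (c * f i)\<^sup>2) summable_on A"
  unfolding power_mult_distrib by (intro summable_on_cmult_right assms)

instantiation ell2 :: (type) real_vector
begin

lift_definition zero_ell2 :: "'a ell2" is "\<lambda>_. 0" by simp
lift_definition plus_ell2 :: "'a ell2 \<Rightarrow> 'a ell2 \<Rightarrow> 'a ell2" is "\<lambda>f g i. f i + g i"
  by (simp add: square_summable_add)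
lift_definition uminus_ell2 :: "'a ell2 \<Rightarrow> 'a ell2" is "\<lambda>f i. - f i" by simp
lift_definition minus_ell2 :: "'a ell2 \<Rightarrow> 'a ell2 \<Rightarrow> 'a ell2" is "\<lambda>f g i. f i - g i"
  by (rule square_summable_add[where g = "\<lambda>i. - g i" for g, simplified])
lift_definition scaleR_ell2 :: "real \<Rightarrow> 'a ell2 \<Rightarrow> 'a ell2" is "\<lambda>c f i. c * f i"
  by (simp add: square_summable_cmult)

instance
  by standard (auto intro!: ell2_eqI simp: plus_ell2.rep_eq minus_ell2.rep_eq uminus_ell2.rep_eq
      zero_ell2.rep_eq scaleR_ell2.rep_eq distrib_left distrib_right)

end

instantiation ell2 :: (type) real_inner
begin

definition inner_ell2 :: "'a ell2 \<Rightarrow> 'a ell2 \<Rightarrow> real" where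
  "inner_ell2 x y = (\<Sum>\<^sub>\<infinity>i. ell2_apply x i * ell2_apply y i)"
definition norm_ell2 :: "'a ell2 \<Rightarrow> real" where
  "norm_ell2 x = sqrt (inner x x)"
definition dist_ell2 :: "'a ell2 \<Rightarrow> 'a ell2 \<Rightarrow> real" where
  "dist_ell2 x y = norm (x - y)"
definition sgn_ell2 :: "'a ell2 \<Rightarrow> 'a ell2" where
  "sgn_ell2 x = x /\<^sub>R norm x"
definition uniformity_ell2 :: "('a ell2 \<times> 'a ell2) filter" where
  "uniformity_ell2 = (INF e\<in>{0<..}. principal {(x, y). dist x y < e})"
definition open_ell2 :: "'a ell2 set \<Rightarrow> bool" where
  "open_ell2 U = (\<forall>x\<in>U. eventually (\<lambda>(x', y). x' = x \<longrightarrow> y \<in> U) uniformity)"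

instance
proof
  fix x y z :: "'a ell2" and c :: real
  have sm: "(\<lambda>i. ell2_apply x i * ell2_apply y i) summable_on UNIV" for x y :: "'a ell2"
    by (intro square_summable_mult ell2_square)
  show "inner x y = inner y x"
    by (simp add: inner_ell2_def mult.commute)
  show "inner (x + y) z = inner x z + inner y z"
    unfolding inner_ell2_def plus_ell2.rep_eq distrib_right by (rule infsum_add[OF sm sm])
  show "inner (c *\<^sub>R x) y = c * inner x y"
    unfolding inner_ell2_def scaleR_ell2.rep_eq mult.assoc by (rule infsum_cmult_right[OF sm])
  show "0 \<le> inner x x"
    by (simp add: inner_ell2_def infsum_nonneg)
  show "inner x x = 0 \<longleftrightarrow> x = 0"
  proof
    assume "inner x x = 0"
    then have "ell2_apply x i * ell2_apply x i = 0" for i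
      unfolding inner_ell2_def
      by (intro nonneg_infsum_le_0D[OF _ sm]) auto
    then show "x = 0" by transfer auto
  qed (simp add: inner_ell2_def zero_ell2.rep_eq)
qed (rule dist_ell2_def norm_ell2_def sgn_ell2_def uniformity_ell2_def open_ell2_def)+

end

lemma ell2_norm_square_has_sum: "((\<lambda>i. (ell2_apply x i)\<^sup>2) has_sum (norm x)\<^sup>2) UNIV"
  unfolding power2_norm_eq_inner inner_ell2_def unfolding power2_eq_square
  by (intro has_sum_infsum square_summable_mult ell2_square)

lemma ell2_sum_le: "finite F \<Longrightarrow> (\<Sum>i\<in>F. (ell2_apply x i)\<^sup>2) \<le> (norm x)\<^sup>2"
  by (rule finite_sum_le_has_sum[OF ell2_norm_square_has_sum]) auto

lemma ell2_apply_le: "\<bar>ell2_apply x i\<bar> \<le> norm x"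
proof -
  have "(ell2_apply x i)\<^sup>2 \<le> (norm x)\<^sup>2" using ell2_sum_le[of "{i}" x] by simp
  then show ?thesis by (metis abs_le_square_iff abs_norm_cancel)
qed

instance ell2 :: (type) complete_space
proof
  fix X :: "nat \<Rightarrow> 'a ell2"
  assume X: "Cauchy X"
  have "Cauchy (\<lambda>n. ell2_apply (X n) i)" for i
  proof (rule metric_CauchyI)
    fix e :: real assume "e > 0"
    then obtain N where N: "\<And>m n. m \<ge> N \<Longrightarrow> n \<ge> N \<Longrightarrow> dist (X m) (X n) < e"
      using X by (meson metric_CauchyD)
    have "dist (ell2_apply (X m) i) (ell2_apply (X n) i) \<le> dist (X m) (X n)" for m n
      using ell2_apply_le[of "X m - X n" i]
      by (simp add: dist_norm minus_ell2.rep_eq)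
    then show "\<exists>M. \<forall>m\<ge>M. \<forall>n\<ge>M. dist (ell2_apply (X m) i) (ell2_apply (X n) i) < e"
      using N by (meson le_less_trans)
  qed
  then have "\<forall>i. \<exists>l. (\<lambda>n. ell2_apply (X n) i) \<longlonglongrightarrow> l"
    using Cauchy_convergent convergent_def by blast
  then obtain L where L: "\<And>i. (\<lambda>n. ell2_apply (X n) i) \<longlonglongrightarrow> L i" by metis
  have bound: "(\<Sum>i\<in>F. (ell2_apply (X n) i - L i)\<^sup>2) \<le> e\<^sup>2"
    if N: "\<And>m n. m \<ge> N \<Longrightarrow> n \<ge> N \<Longrightarrow> dist (X m) (X n) < e" and n: "n \<ge> N" and F: "finite F"
    for e N n F
  proof (rule tendsto_upperbound)
    show "(\<lambda>m. \<Sum>i\<in>F. (ell2_apply (X n) i - ell2_apply (X m) i)\<^sup>2)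
            \<longlonglongrightarrow> (\<Sum>i\<in>F. (ell2_apply (X n) i - L i)\<^sup>2)"
      by (intro tendsto_intros L)
    show "\<forall>\<^sub>F m in sequentially. (\<Sum>i\<in>F. (ell2_apply (X n) i - ell2_apply (X m) i)\<^sup>2) \<le> e\<^sup>2"
    proof (rule eventually_sequentiallyI[of N])
      fix m assume "m \<ge> N"
      have "(\<Sum>i\<in>F. (ell2_apply (X n) i - ell2_apply (X m) i)\<^sup>2) \<le> (norm (X n - X m))\<^sup>2"
        using ell2_sum_le[OF F, of "X n - X m"] by (simp add: minus_ell2.rep_eq)
      also have "\<dots> \<le> e\<^sup>2"
        using N[OF n \<open>m \<ge> N\<close>] by (intro power_mono) (auto simp: dist_norm)
      finally show "(\<Sum>i\<in>F. (ell2_apply (X n) i - ell2_apply (X m) i)\<^sup>2) \<le> e\<^sup>2" .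
    qed
  qed simp
  have diff: "(\<lambda>i. (ell2_apply (X n) i - L i)\<^sup>2) summable_on UNIV"
    if N: "\<And>m n. m \<ge> N \<Longrightarrow> n \<ge> N \<Longrightarrow> dist (X m) (X n) < e" and n: "n \<ge> N" for e N n
    by (rule nonneg_bounded_partial_sums_imp_summable_on[where C = "e\<^sup>2"])
       (auto intro!: eventually_finite_subsets_at_top_weakI bound[OF N n])
  obtain N where N: "\<And>m n. m \<ge> N \<Longrightarrow> n \<ge> N \<Longrightarrow> dist (X m) (X n) < 1"
    using X by (meson metric_CauchyD zero_less_one)
  have "(\<lambda>i. (ell2_apply (X N) i + (- 1) * (ell2_apply (X N) i - L i))\<^sup>2) summable_on UNIV"
    by (intro square_summable_add ell2_square square_summable_cmult diff[OF N]) auto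
  then have L2: "(\<lambda>i. (L i)\<^sup>2) summable_on UNIV" by simp
  define l where "l = Abs_ell2 L"
  have l: "ell2_apply l = L"
    using L2 by (simp add: l_def Abs_ell2_inverse)
  have "X \<longlonglongrightarrow> l"
  proof (rule metric_LIMSEQ_I)
    fix r :: real assume "r > 0"
    then obtain N where N: "\<And>m n. m \<ge> N \<Longrightarrow> n \<ge> N \<Longrightarrow> dist (X m) (X n) < r / 2"
      using X by (meson metric_CauchyD half_gt_zero)
    have "dist (X n) l < r" if "n \<ge> N" for n
    proof -
      have "(norm (X n - l))\<^sup>2 \<le> (r / 2)\<^sup>2"
      proof (rule has_sum_le_finite_sums[OF ell2_norm_square_has_sum])
        fix F :: "'a set" assume "finite F"
        then show "(\<Sum>i\<in>F. (ell2_apply (X n - l) i)\<^sup>2) \<le> (r / 2)\<^sup>2"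
          using bound[OF N that] by (simp add: minus_ell2.rep_eq l)
      qed
      then have "norm (X n - l) \<le> r / 2"
        using \<open>r > 0\<close> by (simp add: power2_le_iff_abs_le)
      then show ?thesis using \<open>r > 0\<close> by (simp add: dist_norm)
    qed
    then show "\<exists>N. \<forall>n\<ge>N. dist (X n) l < r" by blast
  qed
  then show "convergent X" by (rule convergentI)
qed

section \<open>Tensor powers\<close>

lemma parseval_basis_exists:
  "\<exists>B :: 'a :: {real_inner, complete_space} set.
     \<forall>x y. ((\<lambda>b. inner x b * inner y b) has_sum inner x y) B"
proof -
  define ON where "ON = {B :: 'a set. (\<forall>b\<in>B. inner b b = 1) \<and> (\<forall>b\<in>B. \<forall>c\<in>B. b \<noteq> c \<longrightarrow> inner b c = 0)}"
  have "\<exists>M\<in>ON. \<forall>X\<in>ON. M \<subseteq> X \<longrightarrow> X = M"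
  proof (rule subset_Zorn')
    fix C assume C: "subset.chain ON C"
    then have sub: "C \<subseteq> ON" and ch: "\<And>X Y. X \<in> C \<Longrightarrow> Y \<in> C \<Longrightarrow> X \<subseteq> Y \<or> Y \<subseteq> X"
      by (auto simp: subset_chain_def)
    show "\<Union>C \<in> ON"
      unfolding ON_def
    proof (intro CollectI conjI ballI impI)
      show "inner b b = 1" if "b \<in> \<Union>C" for b
        using that sub by (auto simp: ON_def)
      show "inner b c = 0" if bc: "b \<in> \<Union>C" "c \<in> \<Union>C" "b \<noteq> c" for b c
      proof -
        obtain X Y where "X \<in> C" "b \<in> X" "Y \<in> C" "c \<in> Y" using bc by blast
        then obtain Z where "Z \<in> C" "b \<in> Z" "c \<in> Z" using ch[of X Y] by blast
        then show ?thesis using sub bc by (auto simp: ON_def)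
      qed
    qed
  qed
  then obtain B where B: "B \<in> ON" and max: "\<And>X. X \<in> ON \<Longrightarrow> B \<subseteq> X \<Longrightarrow> X = B" by blast
  have unit: "inner b b = 1" if "b \<in> B" for b using B that by (auto simp: ON_def)
  have orth: "inner b c = 0" if "b \<in> B" "c \<in> B" "b \<noteq> c" for b c
    using B that by (auto simp: ON_def)
  have total: "z = 0" if z: "\<And>b. b \<in> B \<Longrightarrow> inner z b = 0" for z
  proof (rule ccontr)
    assume "z \<noteq> 0"
    define u where "u = z /\<^sub>R norm z"
    have uu: "inner u u = 1"
      using \<open>z \<noteq> 0\<close> by (simp add: u_def field_simps power2_norm_eq_inner flip: power2_eq_square)
    have ub: "inner u b = 0" "inner b u = 0" if "b \<in> B" for b
      using z[OF that] by (simp_all add: u_def inner_commute)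
    have "insert u B \<in> ON"
      unfolding ON_def using unit orth uu ub by auto
    then have "u \<in> B" using max by blast
    then show False using ub uu by force
  qed
  define S where "S x F = (\<Sum>b\<in>F. inner x b *\<^sub>R b)" for x :: 'a and F
  have S_inner: "inner (S x F) b = (if b \<in> F then inner x b else 0)"
    if "finite F" "F \<subseteq> B" "b \<in> B" for x F b
  proof -
    have "inner (S x F) b = (\<Sum>c\<in>F. if c = b then inner x b else 0)"
      unfolding S_def inner_sum_left
      by (rule sum.cong) (use that unit orth in auto)
    then show ?thesis using that by simp
  qed
  have S_norm: "(norm (S x F))\<^sup>2 = (\<Sum>b\<in>F. (inner x b)\<^sup>2)" if F: "finite F" "F \<subseteq> B" for x F
  proof -
    have "inner (S x F) (S x F) = (\<Sum>b\<in>F. inner x b * inner (S x F) b)"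
      by (subst (2) S_def) (simp add: inner_sum_right)
    also have "\<dots> = (\<Sum>b\<in>F. (inner x b)\<^sup>2)"
      by (rule sum.cong) (use F in \<open>auto simp: S_inner[OF F] power2_eq_square\<close>)
    finally show ?thesis by (simp add: power2_norm_eq_inner)
  qed
  have bessel: "(\<Sum>b\<in>F. (inner x b)\<^sup>2) \<le> (norm x)\<^sup>2" if F: "finite F" "F \<subseteq> B" for x F
  proof -
    have "inner x (S x F) = (\<Sum>b\<in>F. (inner x b)\<^sup>2)"
      by (simp add: S_def inner_sum_right power2_eq_square)
    moreover have "0 \<le> inner (x - S x F) (x - S x F)" by simp
    ultimately show ?thesis
      using S_norm[OF F, of x]
      by (simp add: power2_norm_eq_inner inner_diff_left inner_diff_right inner_commute)
  qed
  have square: "((\<lambda>b. (inner x b)\<^sup>2) has_sum inner x x) B" for x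
  proof -
    define f where "f = (\<lambda>b. (inner x b)\<^sup>2)"
    have sm: "f summable_on B"
      by (rule nonneg_bounded_partial_sums_imp_summable_on[where C = "(norm x)\<^sup>2"])
         (auto intro!: eventually_finite_subsets_at_top_weakI bessel simp: f_def)
    define s where "s = infsum f B"
    have hs: "(f has_sum s) B" using sm by (simp add: s_def)
    have le_s: "sum f F \<le> s" if "finite F" "F \<subseteq> B" for F
      by (rule finite_sum_le_has_sum[OF hs]) (use that in \<open>auto simp: f_def\<close>)
    have "\<exists>F. finite F \<and> F \<subseteq> B \<and> dist (sum f F) s \<le> 1 / Suc n" for n
      by (rule has_sum_finite_approximation[OF hs]) simp
    then obtain F where F: "\<And>n. finite (F n)" "\<And>n. F n \<subseteq> B"
      and near: "\<And>n. dist (sum f (F n)) s \<le> 1 / Suc n" by metis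
    have dist_S: "(dist (S x (F m)) (S x (F n)))\<^sup>2 \<le> 1 / Suc m + 1 / Suc n" for m n
    proof -
      define D E where "D = F m - F n" and "E = F n - F m"
      have fin: "finite D" "finite E" "D \<subseteq> B" "E \<subseteq> B" "D \<inter> E = {}" "D \<inter> F n = {}" "E \<inter> F m = {}"
        using F by (auto simp: D_def E_def)
      have "S x (F m) - S x (F n) = S x D - S x E"
        using sum.Int_Diff[OF F(1)[of m], of "\<lambda>b. inner x b *\<^sub>R b" "F n"]
          sum.Int_Diff[OF F(1)[of n], of "\<lambda>b. inner x b *\<^sub>R b" "F m"]
        unfolding S_def D_def E_def by (simp add: Int_commute)
      moreover have "inner (S x D) (S x E) = 0"
        unfolding S_def[of x E] inner_sum_right
        using fin by (intro sum.neutral) (auto simp: S_inner subset_iff)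
      ultimately have "(dist (S x (F m)) (S x (F n)))\<^sup>2 = (norm (S x D))\<^sup>2 + (norm (S x E))\<^sup>2"
        by (simp add: dist_norm power2_norm_eq_inner inner_diff_left inner_diff_right inner_commute)
      also have "\<dots> = sum f D + sum f E"
        using fin by (simp add: S_norm f_def)
      also have "sum f D \<le> s - sum f (F n)"
        using le_s[of "D \<union> F n"] fin F by (simp add: sum.union_disjoint)
      also have "sum f E \<le> s - sum f (F m)"
        using le_s[of "E \<union> F m"] fin F by (simp add: sum.union_disjoint)
      finally show ?thesis
        using near[of m] near[of n] by (simp add: dist_real_def)
    qed
    have "Cauchy (\<lambda>n. S x (F n))"
    proof (rule metric_CauchyI)
      fix e :: real assume "e > 0"
      then obtain N where N: "1 / Suc N < e\<^sup>2 / 2"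
        using nat_approx_posE[of "e\<^sup>2 / 2"] by auto
      have "dist (S x (F m)) (S x (F n)) < e" if "m \<ge> N" "n \<ge> N" for m n
      proof -
        have "1 / real (Suc m) \<le> 1 / real (Suc N)" "1 / real (Suc n) \<le> 1 / real (Suc N)"
          using that by (auto intro!: divide_left_mono)
        then have "(dist (S x (F m)) (S x (F n)))\<^sup>2 < e\<^sup>2"
          using dist_S[of m n] N by linarith
        then show ?thesis using \<open>e > 0\<close> by (simp add: power2_less_imp_less)
      qed
      then show "\<exists>M. \<forall>m\<ge>M. \<forall>n\<ge>M. dist (S x (F m)) (S x (F n)) < e" by blast
    qed
    then obtain p where p: "(\<lambda>n. S x (F n)) \<longlonglongrightarrow> p"
      using Cauchy_convergent convergent_def by blast
    have inv_lim: "(\<lambda>n. 1 / real (Suc n)) \<longlonglongrightarrow> 0"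
      using LIMSEQ_inverse_real_of_nat by (simp add: inverse_eq_divide)
    have "inner (x - p) b = 0" if b: "b \<in> B" for b
    proof -
      have "(\<lambda>n. inner (S x (F n)) b) \<longlonglongrightarrow> inner p b"
        by (intro tendsto_intros p)
      moreover have "(\<lambda>n. inner (S x (F n)) b) \<longlonglongrightarrow> inner x b"
      proof (cases "inner x b = 0")
        case True
        then have "inner (S x (F n)) b = 0" for n using F b by (auto simp: S_inner)
        then show ?thesis using True by simp
      next
        case False
        then have "f b > 0" by (simp add: f_def)
        then obtain N where N: "1 / Suc N < f b"
          using nat_approx_posE[of "f b"] by auto
        have "b \<in> F n" if "n \<ge> N" for n
        proof (rule ccontr)
          assume "b \<notin> F n"
          then have "f b + sum f (F n) \<le> s"
            using le_s[of "insert b (F n)"] F b by simp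
          moreover have "1 / real (Suc n) \<le> 1 / real (Suc N)"
            using that by (auto intro!: divide_left_mono)
          ultimately show False using near[of n] N by (simp add: dist_real_def)
        qed
        then have "\<forall>\<^sub>F n in sequentially. inner (S x (F n)) b = inner x b"
          using F b by (auto simp: S_inner eventually_sequentially)
        then show ?thesis by (rule tendsto_eventually)
      qed
      ultimately show ?thesis
        using LIMSEQ_unique by (fastforce simp: inner_diff_left)
    qed
    then have "x = p" using total[of "x - p"] by simp
    then have "(\<lambda>n. (norm (S x (F n)))\<^sup>2) \<longlonglongrightarrow> (norm x)\<^sup>2"
      using p by (intro tendsto_intros) simp
    then have "(\<lambda>n. sum f (F n)) \<longlonglongrightarrow> inner x x"
      unfolding S_norm[OF F] f_def power2_norm_eq_inner[of x] .
    moreover have "(\<lambda>n. sum f (F n)) \<longlonglongrightarrow> s"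
      by (rule metric_tendsto_imp_tendsto[OF inv_lim]) (use near in auto)
    ultimately have "s = inner x x" using LIMSEQ_unique by blast
    then show ?thesis using hs by (simp add: f_def)
  qed
  have "((\<lambda>b. inner x b * inner y b) has_sum inner x y) B" for x y
  proof -
    have "((\<lambda>b. ((inner (x + y) b)\<^sup>2 + (- 1) * (inner (x - y) b)\<^sup>2) * (1 / 4))
            has_sum (inner (x + y) (x + y) + (- 1) * inner (x - y) (x - y)) * (1 / 4)) B"
      by (intro has_sum_cmult_left has_sum_add has_sum_cmult_right square)
    moreover have "((inner (x + y) b)\<^sup>2 + (- 1) * (inner (x - y) b)\<^sup>2) * (1 / 4) = inner x b * inner y b" for b
      unfolding inner_add_left inner_diff_left by (simp add: power2_eq_square algebra_simps)
    moreover have "(inner (x + y) (x + y) + (- 1) * inner (x - y) (x - y)) * (1 / 4) = inner x y"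
      by (simp add: inner_add_left inner_add_right inner_diff_left inner_diff_right inner_commute[of y x])
    ultimately show ?thesis by simp
  qed
  then show ?thesis by blast
qed

lemma tensor_coordinates_has_sum:
  fixes B :: "'a :: {real_inner, complete_space} set"
  assumes B: "\<And>x y. ((\<lambda>b. inner x b * inner y b) has_sum inner x y) B"
  shows "length xs = length ys \<Longrightarrow>
    ((\<lambda>bs. prod_list (map2 inner xs bs) * prod_list (map2 inner ys bs))
       has_sum prod_list (map2 inner xs ys)) {bs. set bs \<subseteq> B \<and> length bs = length xs}"
proof (induction xs ys rule: list_induct2)
  case Nil
  have "{bs :: 'a list. set bs \<subseteq> B \<and> length bs = length ([] :: 'a list)} = {[]}" by auto
  then show ?case using has_sum_finite[of "{[] :: 'a list}" "\<lambda>_. 1 :: real"] by simp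
next
  case (Cons x xs y ys)
  define L where "L = {bs. set bs \<subseteq> B \<and> length bs = length xs}"
  define f where "f = (\<lambda>b. inner x b * inner y b)"
  define g where "g = (\<lambda>bs. prod_list (map2 inner xs bs) * prod_list (map2 inner ys bs))"
  have f: "(f has_sum inner x y) B" using B by (simp add: f_def)
  have g: "(g has_sum prod_list (map2 inner xs ys)) L"
    using Cons.IH by (simp add: g_def L_def)
  have fa: "(\<lambda>b. norm (f b)) summable_on B" and ga: "(\<lambda>bs. norm (g bs)) summable_on L"
    using f g has_sum_imp_summable summable_on_iff_abs_summable_on_real by blast+
  have "(\<lambda>p. norm (f (fst p) * g (snd p))) summable_on B \<times> L"
    unfolding Infinite_Sum.abs_summable_on_Sigma_iff
    using fa ga by (auto simp: abs_mult infsum_cmult_right' infsum_nonneg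
        intro!: summable_on_cmult_right summable_on_cmult_left)
  then have sm: "(\<lambda>p. f (fst p) * g (snd p)) summable_on B \<times> L"
    using summable_on_iff_abs_summable_on_real by blast
  have "((\<lambda>p. f (fst p) * g (snd p)) has_sum (inner x y * prod_list (map2 inner xs ys))) (B \<times> L)"
  proof (rule has_sum_SigmaI[OF _ _ sm])
    show "((\<lambda>bs. f (fst (b, bs)) * g (snd (b, bs))) has_sum f b * prod_list (map2 inner xs ys)) L" for b
      using g by (simp add: has_sum_cmult_right)
    show "((\<lambda>b. f b * prod_list (map2 inner xs ys)) has_sum inner x y * prod_list (map2 inner xs ys)) B"
      using f by (rule has_sum_cmult_left)
  qed
  moreover have bij: "bij_betw (\<lambda>p. fst p # snd p) (B \<times> L)
      {bs. set bs \<subseteq> B \<and> length bs = length (x # xs)}"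
    by (rule bij_betwI[where g = "\<lambda>bs. (hd bs, tl bs)"])
       (auto simp: L_def length_Suc_conv)
  moreover have "prod_list (map2 inner (x # xs) (b # bs)) * prod_list (map2 inner (y # ys) (b # bs))
      = f b * g bs" for b bs
    by (simp add: f_def g_def)
  ultimately show ?case
    by (subst has_sum_reindex_bij_betw[OF bij, symmetric]) simp
qed

lemma elementary_tensors_exist:
  "\<exists>T :: 'a :: {real_inner, complete_space} list \<Rightarrow> 'a list ell2. \<forall>xs ys.
     inner (T xs) (T ys) =
       (if length xs = length ys then \<Prod>i<length xs. inner (xs ! i) (ys ! i) else 0)"
proof -
  obtain B :: "'a set" where B: "\<And>x y. ((\<lambda>b. inner x b * inner y b) has_sum inner x y) B"
    using parseval_basis_exists by blast
  define t where "t xs bs = (if set bs \<subseteq> B \<and> length bs = length xs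
      then prod_list (map2 inner xs bs) else 0)" for xs bs :: "'a list"
  have t: "((\<lambda>bs. t xs bs * t ys bs) has_sum
      (if length xs = length ys then prod_list (map2 inner xs ys) else 0)) UNIV" for xs ys
  proof (cases "length xs = length ys")
    case True
    have "((\<lambda>bs. t xs bs * t ys bs) has_sum prod_list (map2 inner xs ys)) UNIV \<longleftrightarrow>
      ((\<lambda>bs. prod_list (map2 inner xs bs) * prod_list (map2 inner ys bs))
       has_sum prod_list (map2 inner xs ys)) {bs. set bs \<subseteq> B \<and> length bs = length xs}"
      by (rule has_sum_cong_neutral) (use True in \<open>auto simp: t_def\<close>)
    then show ?thesis using tensor_coordinates_has_sum[OF B True] True by simp
  next
    case False
    then have "(\<lambda>bs. t xs bs * t ys bs) = (\<lambda>_. 0)" by (auto simp: t_def fun_eq_iff)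
    then show ?thesis using False by simp
  qed
  have t2: "(\<lambda>bs. (t xs bs)\<^sup>2) summable_on UNIV" for xs
    using t[of xs xs] by (auto simp: power2_eq_square dest: has_sum_imp_summable)
  have prod: "prod_list (map2 inner xs ys) = (\<Prod>i<length xs. inner (xs ! i) (ys ! i))"
    if "length xs = length ys" for xs ys :: "'a list"
    using that by (simp add: prod.list_conv_set_nth lessThan_atLeast0)
  show ?thesis
  proof (intro exI[of _ "\<lambda>xs. Abs_ell2 (t xs)"] allI)
    fix xs ys
    have "inner (Abs_ell2 (t xs)) (Abs_ell2 (t ys)) = (\<Sum>\<^sub>\<infinity>bs. t xs bs * t ys bs)"
      using t2 by (simp add: inner_ell2_def Abs_ell2_inverse)
    also have "\<dots> = (if length xs = length ys then prod_list (map2 inner xs ys) else 0)"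
      using t by (rule infsumI)
    finally show "inner (Abs_ell2 (t xs)) (Abs_ell2 (t ys)) =
      (if length xs = length ys then \<Prod>i<length xs. inner (xs ! i) (ys ! i) else 0)"
      by (simp add: prod)
  qed
qed

text \<open>All tensor powers of a real Hilbert space \<open>\<K>\<close> are realised as pairwise orthogonal closed
  subspaces of one ambient Hilbert space: \<open>etens [x\<^sub>1, \<dots>, x\<^sub>n]\<close> is
  \<open>x\<^sub>1 \<otimes> \<dots> \<otimes> x\<^sub>n\<close>. The choice of \<open>etens\<close> is
  immaterial, because the inner products of elementary tensors determine \<open>\<K>\<^sup>\<otimes>\<^sup>n\<close> up to
  a unique unitary map preserving elementary tensors; multilinearity is a consequence of them as well.
  \<open>\<K>\<^sup>\<otimes>\<^sup>0\<close> is the line spanned by the unit vector \<open>etens []\<close>, i.e. \<open>\<real>\<close>.\<close>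

definition etens :: "'a :: {real_inner, complete_space} list \<Rightarrow> 'a list ell2" where
  "etens = (SOME T. \<forall>xs ys. inner (T xs) (T ys) =
     (if length xs = length ys then \<Prod>i<length xs. inner (xs ! i) (ys ! i) else 0))"

lemma inner_etens:
  "inner (etens xs) (etens ys) =
     (if length xs = length ys then \<Prod>i<length xs. inner (xs ! i) (ys ! i) else 0)"
  using someI_ex[OF elementary_tensors_exist] unfolding etens_def by blast

definition tensor_power :: "nat \<Rightarrow> 'a :: {real_inner, complete_space} list ell2 set" where
  "tensor_power n = closure (span {etens xs | xs. length xs = n})"

text \<open>The bounded linear operator on \<open>\<K>\<^sup>\<otimes>\<^sup>n\<close> with prescribed values on elementary
  tensors; it is determined on \<^const>\<open>tensor_power\<close>, and only used there.\<close>

definition tensor_extend ::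
    "nat \<Rightarrow> ('a :: {real_inner, complete_space} list \<Rightarrow> 'b :: real_normed_vector) \<Rightarrow> 'a list ell2 \<Rightarrow> 'b" where
  "tensor_extend n \<phi> = (SOME A. bounded_linear A \<and> (\<forall>xs. length xs = n \<longrightarrow> A (etens xs) = \<phi> xs))"

definition tensor_map ::
    "nat \<Rightarrow> ('a :: {real_inner, complete_space} \<Rightarrow> 'b :: {real_inner, complete_space})
      \<Rightarrow> 'a list ell2 \<Rightarrow> 'b list ell2" where
  "tensor_map n J = tensor_extend n (\<lambda>xs. etens (map J xs))"

text \<open>The multiplication \<open>\<K>\<^sup>\<otimes>\<^sup>i \<times> \<K>\<^sup>\<otimes>\<^sup>j \<rightarrow> \<K>\<^sup>\<otimes>\<^sup>(\<^sup>i\<^sup>+\<^sup>j\<^sup>)\<close>. The degrees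
  have to be fixed: it does not extend boundedly to the whole ambient space.\<close>

definition tensor_mult ::
    "nat \<Rightarrow> nat \<Rightarrow> 'a :: {real_inner, complete_space} list ell2 \<Rightarrow> 'a list ell2 \<Rightarrow> 'a list ell2" where
  "tensor_mult i j = (SOME m. bounded_bilinear m \<and>
     (\<forall>xs ys. length xs = i \<longrightarrow> length ys = j \<longrightarrow> m (etens xs) (etens ys) = etens (xs @ ys)))"

section \<open>The \<open>q\<close>-Fock space\<close>

text \<open>The topology of the norm \<open>\<nu>\<close> on \<open>S\<close>, spelled out through balls. The facts about the
  library constant \<^const>\<open>Metric_space.mtopology\<close> presuppose the metric axioms, which for the
  \<open>q\<close>-Fock norm amount to the strict positivity of the operators \<open>P\<^sub>q\<close>.\<close>

definition norm_topology ::
    "(nat \<Rightarrow> 'i ell2) set \<Rightarrow> ((nat \<Rightarrow> 'i ell2) \<Rightarrow> real) \<Rightarrow> (nat \<Rightarrow> 'i ell2) topology" where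
  "norm_topology S \<nu> =
     topology (\<lambda>U. U \<subseteq> S \<and> (\<forall>F\<in>U. \<exists>e>0. \<forall>G\<in>S. \<nu> (\<lambda>n. F n - G n) < e \<longrightarrow> G \<in> U))"

lemma openin_norm_topology:
  "openin (norm_topology S \<nu>) U \<longleftrightarrow>
     U \<subseteq> S \<and> (\<forall>F\<in>U. \<exists>e>0. \<forall>G\<in>S. \<nu> (\<lambda>n. F n - G n) < e \<longrightarrow> G \<in> U)"
proof -
  have "istopology (\<lambda>U. U \<subseteq> S \<and> (\<forall>F\<in>U. \<exists>e>0. \<forall>G\<in>S. \<nu> (\<lambda>n. F n - G n) < e \<longrightarrow> G \<in> U))"
    unfolding istopology_def
  proof (intro conjI allI impI)
    fix U V
    assume U: "U \<subseteq> S \<and> (\<forall>F\<in>U. \<exists>e>0. \<forall>G\<in>S. \<nu> (\<lambda>n. F n - G n) < e \<longrightarrow> G \<in> U)"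
      and V: "V \<subseteq> S \<and> (\<forall>F\<in>V. \<exists>e>0. \<forall>G\<in>S. \<nu> (\<lambda>n. F n - G n) < e \<longrightarrow> G \<in> V)"
    show "U \<inter> V \<subseteq> S" using U by blast
    show "\<forall>F\<in>U \<inter> V. \<exists>e>0. \<forall>G\<in>S. \<nu> (\<lambda>n. F n - G n) < e \<longrightarrow> G \<in> U \<inter> V"
    proof
      fix F assume "F \<in> U \<inter> V"
      then obtain d e where "d > 0" "\<forall>G\<in>S. \<nu> (\<lambda>n. F n - G n) < d \<longrightarrow> G \<in> U"
        and "e > 0" "\<forall>G\<in>S. \<nu> (\<lambda>n. F n - G n) < e \<longrightarrow> G \<in> V"
        using U V by blast
      then show "\<exists>e>0. \<forall>G\<in>S. \<nu> (\<lambda>n. F n - G n) < e \<longrightarrow> G \<in> U \<inter> V"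
        by (intro exI[of _ "min d e"]) simp
    qed
  next
    fix \<K> assume *: "\<forall>U\<in>\<K>. U \<subseteq> S \<and> (\<forall>F\<in>U. \<exists>e>0. \<forall>G\<in>S. \<nu> (\<lambda>n. F n - G n) < e \<longrightarrow> G \<in> U)"
    then show "\<Union>\<K> \<subseteq> S" by blast
    show "\<forall>F\<in>\<Union>\<K>. \<exists>e>0. \<forall>G\<in>S. \<nu> (\<lambda>n. F n - G n) < e \<longrightarrow> G \<in> \<Union>\<K>"
    proof
      fix F assume "F \<in> \<Union>\<K>"
      then obtain U where "U \<in> \<K>" "F \<in> U" by blast
      then obtain e where "e > 0" "\<forall>G\<in>S. \<nu> (\<lambda>n. F n - G n) < e \<longrightarrow> G \<in> U" using * by blast
      then show "\<exists>e>0. \<forall>G\<in>S. \<nu> (\<lambda>n. F n - G n) < e \<longrightarrow> G \<in> \<Union>\<K>"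
        using \<open>U \<in> \<K>\<close> by blast
    qed
  qed
  then show ?thesis by (simp add: norm_topology_def topology_inverse')
qed

definition inversions :: "nat \<Rightarrow> (nat \<Rightarrow> nat) \<Rightarrow> nat" where
  "inversions n \<pi> = card {(i, j). i < j \<and> j < n \<and> \<pi> i > \<pi> j}"

definition q_operator :: "real \<Rightarrow> nat \<Rightarrow> 'a :: {real_inner, complete_space} list ell2 \<Rightarrow> 'a list ell2" where
  "q_operator q n = tensor_extend n
     (\<lambda>xs. \<Sum>\<pi> | \<pi> permutes {..<n}. q ^ inversions n \<pi> *\<^sub>R etens (map (\<lambda>i. xs ! \<pi> i) [0..<n]))"

definition fock_space :: "real \<Rightarrow> (nat \<Rightarrow> 'a :: {real_inner, complete_space} list ell2) set" where
  "fock_space q = {F. (\<forall>n. F n \<in> tensor_power n) \<and> summable (\<lambda>n. inner (q_operator q n (F n)) (F n))}"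

definition fock_inner ::
    "real \<Rightarrow> (nat \<Rightarrow> 'a :: {real_inner, complete_space} list ell2) \<Rightarrow> (nat \<Rightarrow> 'a list ell2) \<Rightarrow> real" where
  "fock_inner q F G = (\<Sum>n. inner (q_operator q n (F n)) (G n))"

definition fock_norm :: "real \<Rightarrow> (nat \<Rightarrow> 'a :: {real_inner, complete_space} list ell2) \<Rightarrow> real" where
  "fock_norm q F = sqrt (fock_inner q F F)"

definition fock_topology ::
    "real \<Rightarrow> (nat \<Rightarrow> 'a :: {real_inner, complete_space} list ell2) topology" where
  "fock_topology q = norm_topology (fock_space q) (fock_norm q)"

section \<open>The spaces \<open>\<G>\<^sub>q\<close>\<close>

definition q_int :: "real \<Rightarrow> nat \<Rightarrow> real" where
  "q_int q n = (\<Sum>k<n. q ^ k)"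

definition q_fact :: "real \<Rightarrow> nat \<Rightarrow> real" where
  "q_fact q n = (\<Prod>k = 1..n. q_int q k)"

definition G_space ::
    "real \<Rightarrow> real \<Rightarrow> real \<Rightarrow> (nat \<Rightarrow> 'a :: {real_inner, complete_space} list ell2) set" where
  "G_space q r \<alpha> = {F. (\<forall>n. F n \<in> tensor_power n) \<and>
     summable (\<lambda>n. (norm (F n))\<^sup>2 * r ^ n * q_fact q n powr \<alpha>)}"

definition G_norm ::
    "real \<Rightarrow> real \<Rightarrow> real \<Rightarrow> (nat \<Rightarrow> 'a :: {real_inner, complete_space} list ell2) \<Rightarrow> real" where
  "G_norm q r \<alpha> F = sqrt (\<Sum>n. (norm (F n))\<^sup>2 * r ^ n * q_fact q n powr \<alpha>)"

definition G_topology ::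
    "real \<Rightarrow> real \<Rightarrow> real \<Rightarrow> (nat \<Rightarrow> 'a :: {real_inner, complete_space} list ell2) topology" where
  "G_topology q r \<alpha> = norm_topology (G_space q r \<alpha>) (G_norm q r \<alpha>)"

definition G_lim :: "real \<Rightarrow> real \<Rightarrow> (nat \<Rightarrow> 'a :: {real_inner, complete_space} list ell2) set" where
  "G_lim q \<alpha> = (\<Inter>r\<in>{1..}. G_space q r \<alpha>)"

text \<open>The projective limit topology: the coarsest one making all inclusions into the
  \<^term>\<open>G_space q r \<alpha>\<close> continuous.\<close>

definition G_lim_topology ::
    "real \<Rightarrow> real \<Rightarrow> (nat \<Rightarrow> 'a :: {real_inner, complete_space} list ell2) topology" where
  "G_lim_topology q \<alpha> =
     topology_generated_by {G_lim q \<alpha> \<inter> U | U r. r \<ge> 1 \<and> openin (G_topology q r \<alpha>) U}"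

text \<open>The canonical map induced by an embedding \<open>J\<close> of \<open>\<H>\<^sub>+\<close> into \<open>\<H>\<close>.\<close>

definition fock_embedding ::
    "('a :: {real_inner, complete_space} \<Rightarrow> 'b :: {real_inner, complete_space})
      \<Rightarrow> (nat \<Rightarrow> 'a list ell2) \<Rightarrow> nat \<Rightarrow> 'b list ell2" where
  "fock_embedding J F = (\<lambda>n. tensor_map n J (F n))"

section \<open>Tensor multiplication of sequences\<close>

definition seq_tensor ::
    "(nat \<Rightarrow> 'a :: {real_inner, complete_space} list ell2) \<Rightarrow> (nat \<Rightarrow> 'a list ell2) \<Rightarrow> nat \<Rightarrow> 'a list ell2"
    (infixl "\<otimes>\<^sub>s" 70) where
  "F \<otimes>\<^sub>s G = (\<lambda>n. \<Sum>i\<le>n. tensor_mult i (n - i) (F i) (G (n - i)))"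

definition seq_add ::
    "(nat \<Rightarrow> 'a list ell2) \<Rightarrow> (nat \<Rightarrow> 'a list ell2) \<Rightarrow> nat \<Rightarrow> 'a list ell2" (infixl "\<oplus>\<^sub>s" 65) where
  "F \<oplus>\<^sub>s G = (\<lambda>n. F n + G n)"

definition seq_scale :: "real \<Rightarrow> (nat \<Rightarrow> 'a list ell2) \<Rightarrow> nat \<Rightarrow> 'a list ell2" (infixr "\<odot>\<^sub>s" 75) where
  "c \<odot>\<^sub>s F = (\<lambda>n. c *\<^sub>R F n)"

text \<open>The laws of \<^class>\<open>real_algebra\<close> (associative, no unit demanded), relativised to \<open>A\<close>. The
  vector space laws hold automatically since addition and scaling are componentwise.\<close>

definition tensor_algebra_on :: "(nat \<Rightarrow> 'a :: {real_inner, complete_space} list ell2) set \<Rightarrow> bool" where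
  "tensor_algebra_on A \<longleftrightarrow>
     (\<lambda>_. 0) \<in> A \<and>
     (\<forall>F\<in>A. \<forall>G\<in>A. F \<oplus>\<^sub>s G \<in> A) \<and>
     (\<forall>c. \<forall>F\<in>A. c \<odot>\<^sub>s F \<in> A) \<and>
     (\<forall>F\<in>A. \<forall>G\<in>A. F \<otimes>\<^sub>s G \<in> A) \<and>
     (\<forall>F\<in>A. \<forall>G\<in>A. \<forall>K\<in>A. (F \<otimes>\<^sub>s G) \<otimes>\<^sub>s K = F \<otimes>\<^sub>s (G \<otimes>\<^sub>s K)) \<and>
     (\<forall>F\<in>A. \<forall>G\<in>A. \<forall>K\<in>A. (F \<oplus>\<^sub>s G) \<otimes>\<^sub>s K = (F \<otimes>\<^sub>s K) \<oplus>\<^sub>s (G \<otimes>\<^sub>s K)) \<and>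
     (\<forall>F\<in>A. \<forall>G\<in>A. \<forall>K\<in>A. F \<otimes>\<^sub>s (G \<oplus>\<^sub>s K) = (F \<otimes>\<^sub>s G) \<oplus>\<^sub>s (F \<otimes>\<^sub>s K)) \<and>
     (\<forall>c. \<forall>F\<in>A. \<forall>G\<in>A. (c \<odot>\<^sub>s F) \<otimes>\<^sub>s G = c \<odot>\<^sub>s (F \<otimes>\<^sub>s G) \<and> F \<otimes>\<^sub>s (c \<odot>\<^sub>s G) = c \<odot>\<^sub>s (F \<otimes>\<^sub>s G))"

end

theory Submission
  imports Defs
begin

text \<open>
  Continuity, injectivity and density of the embedding, and the estimate for the product, are reduced
  to statements about a single tensor power.

  Bounded operators on tensor powers are produced by comparing Gram kernels: if the kernel
  \<open>C\<^sup>2 (e\<^sub>k, e\<^sub>l) - (f\<^sub>k, f\<^sub>l)\<close> is positive semidefinite, then \<open>e\<^sub>k \<mapsto> f\<^sub>k\<close> extends to an operator of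
  norm at most \<open>C\<close> (\<open>operator_from_gram_bound\<close>). The Gram kernel of elementary tensors is a product of
  Gram kernels of vectors, so Schur's product theorem makes the tensor powers of a contraction
  contractions again (\<open>contraction_tensor_power\<close>), while permutations of the factors and the juxtaposition
  \<open>\<K>\<^sup>\<otimes>\<^sup>i \<times> \<K>\<^sup>\<otimes>\<^sup>j \<rightarrow> \<K>\<^sup>\<otimes>\<^sup>(\<^sup>i\<^sup>+\<^sup>j\<^sup>)\<close> preserve Gram kernels exactly; hence \<open>\<parallel>f \<otimes> g\<parallel> = \<parallel>f\<parallel> \<parallel>g\<parallel>\<close>
  (\<open>norm_tensor_mult\<close>).

  Since \<open>\<bar>q\<bar> < 1\<close>, everything that depends on \<open>q\<close> grows at most exponentially. On the one hand, the norm of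
  \<open>P\<^sub>q\<^sup>(\<^sup>n\<^sup>)\<close> is at most the sum of \<open>\<bar>q\<bar>\<^sup>i\<^sup>n\<^sup>v\<^sup>(\<^sup>\<pi>\<^sup>)\<close> over all permutations, and Lehmer codes bound this
  by \<open>(1 / (1 - \<bar>q\<bar>))\<^sup>n\<close> (\<open>sum_power_inversions_le\<close>). On the other hand, \<open>[n]\<^sub>q! (1 - q)\<^sup>n\<close> stays between two positive constants,
  because the infinite product of the factors \<open>1 - q\<^sup>k\<close> converges to a nonzero limit (\<open>q_fact_two_sided_bound\<close>). The first fact and the lower bound in
  the second one show that the embedding of \<open>\<G>\<^sub>q(\<H>\<^sub>+, r, \<alpha>)\<close> into \<open>\<F>\<^sub>q(\<H>)\<close> is bounded for large \<open>r\<close>,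
  which gives continuity (\<open>fock_embedding_bounded\<close>). The second fact makes the weights \<open>([n]\<^sub>q!)\<^sup>\<alpha>\<close> submultiplicative up to a
  constant, and then the estimate for \<open>F \<otimes> G\<close> follows from the Cauchy product of the series of squared
  norms; the factor \<open>n + 1\<close> lost to the Cauchy--Schwarz inequality is paid for by \<open>s > r\<close>
  (\<open>G_space_seq_tensor\<close>).

  Density holds because a sequence in the Fock space can be truncated and each of the remaining
  components approximated in the range of \<open>J\<^sup>\<otimes>\<^sup>n\<close> (\<open>fock_embedding_dense\<close>). Injectivity is the dual statement: the kernel of
  \<open>J\<^sup>\<otimes>\<^sup>n\<close> is orthogonal to the range of the tensor power of the adjoint of \<open>J\<close>, and this range is dense
  because \<open>J\<close> is injective (\<open>inj_on_tensor_map\<close>).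
\<close>

section \<open>Closed subspaces of Hilbert spaces\<close>

lemma subspace_closure:
  fixes S :: "'a :: real_normed_vector set"
  assumes S: "subspace S"
  shows "subspace (closure S)"
  unfolding subspace_def
proof (intro conjI ballI allI)
  show "0 \<in> closure S"
    using closure_subset subspace_0[OF S] by blast
next
  fix x y
  assume "x \<in> closure S" "y \<in> closure S"
  then obtain u v where "\<And>n. u n \<in> S" "\<And>n. v n \<in> S" "u \<longlonglongrightarrow> x" "v \<longlonglongrightarrow> y"
    unfolding closure_sequential by blast
  then show "x + y \<in> closure S"
    unfolding closure_sequential
    by (intro exI[of _ "\<lambda>n. u n + v n"]) (auto intro: tendsto_add subspace_add[OF S])
next
  fix c x
  assume "x \<in> closure S"
  then obtain u where "\<And>n. u n \<in> S" "u \<longlonglongrightarrow> x"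
    unfolding closure_sequential by blast
  then show "c *\<^sub>R x \<in> closure S"
    unfolding closure_sequential
    by (intro exI[of _ "\<lambda>n. c *\<^sub>R u n"]) (auto intro: tendsto_scaleR subspace_scale[OF S])
qed

lemma bounded_linear_eq_on_closure_span:
  assumes A: "bounded_linear A" and B: "bounded_linear B"
    and eq: "\<And>x. x \<in> X \<Longrightarrow> A x = B x"
    and x: "x \<in> closure (span X)"
  shows "A x = B x"
proof -
  have AB: "bounded_linear (\<lambda>x. A x - B x)"
    using A B by (rule bounded_linear_sub)
  let ?N = "{x. A x - B x = 0}"
  have "closed ?N"
    using bounded_linear.continuous_on[OF AB continuous_on_id]
    by (intro closed_Collect_eq continuous_on_const)
  moreover have "subspace ?N"
    using AB by (intro linear_subspace_kernel bounded_linear.linear)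
  ultimately have "closure (span X) \<subseteq> ?N"
    using eq by (intro closure_minimal span_minimal) auto
  then show ?thesis using x by auto
qed

text \<open>The functional \<open>\<phi>\<close> is represented by the minimiser of \<open>\<parallel>z\<parallel>\<^sup>2 - 2 \<phi> z\<close> on \<open>S\<close>; a
  minimising sequence is Cauchy by the parallelogram identity. With \<open>S = UNIV\<close> this is Riesz'
  theorem, with \<open>\<phi> = inner x\<close> it is the orthogonal projection of \<open>x\<close> onto \<open>S\<close>.\<close>

lemma riesz_on_closed_subspace:
  fixes \<phi> :: "'a :: {real_inner, complete_space} \<Rightarrow> real"
  assumes \<phi>: "bounded_linear \<phi>" and S: "subspace S" and cl: "closed S"
  obtains z where "z \<in> S" and "\<And>v. v \<in> S \<Longrightarrow> \<phi> v = inner z v"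
proof -
  interpret \<phi>: bounded_linear \<phi> by fact
  define E where "E z = inner z z - 2 * \<phi> z" for z
  obtain K where K: "\<And>x. \<bar>\<phi> x\<bar> \<le> norm x * K"
    using \<phi>.bounded by (auto simp: real_norm_def)
  have lower: "E z \<ge> - K\<^sup>2" for z
  proof -
    have "0 \<le> (norm z - K)\<^sup>2" by simp
    also have "\<dots> = (norm z)\<^sup>2 - 2 * (norm z * K) + K\<^sup>2"
      by (simp add: power2_diff)
    finally show ?thesis
      using K[of z] by (simp add: E_def power2_norm_eq_inner abs_le_iff)
  qed
  define m where "m = Inf (E ` S)"
  have bdd: "bdd_below (E ` S)" using lower by (intro bdd_belowI2)
  have ne: "E ` S \<noteq> {}" using subspace_0[OF S] by auto
  have m_le: "m \<le> E z" if "z \<in> S" for z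
    unfolding m_def using bdd that by (intro cInf_lower) auto
  have "\<exists>z\<in>S. E z < m + 1 / Suc n" for n
    using cInf_lessD[OF ne, of "m + 1 / Suc n"] by (auto simp: m_def)
  then obtain z where zS: "\<And>n. z n \<in> S" and z: "\<And>n. E (z n) < m + 1 / Suc n" by metis
  have near: "(dist (z k) (z n))\<^sup>2 \<le> 2 * (1 / Suc k) + 2 * (1 / Suc n)" for k n
  proof -
    define w where "w = (1 / 2) *\<^sub>R (z k + z n)"
    have "w \<in> S" unfolding w_def by (intro subspace_scale[OF S] subspace_add[OF S] zS)
    moreover have "(dist (z k) (z n))\<^sup>2 = 2 * E (z k) + 2 * E (z n) - 4 * E w"
      unfolding dist_norm power2_norm_eq_inner E_def w_def
      by (simp add: \<phi>.scaleR \<phi>.add inner_simps inner_commute algebra_simps)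
    ultimately show ?thesis using z[of k] z[of n] m_le[of w] by linarith
  qed
  have "Cauchy z"
  proof (rule metric_CauchyI)
    fix e :: real assume e: "e > 0"
    then obtain N where N: "1 / Suc N < e\<^sup>2 / 4"
      using nat_approx_posE[of "e\<^sup>2 / 4"] by auto
    have "dist (z k) (z n) < e" if "k \<ge> N" "n \<ge> N" for k n
    proof -
      have "1 / real (Suc k) \<le> 1 / real (Suc N)" "1 / real (Suc n) \<le> 1 / real (Suc N)"
        using that by (auto intro!: divide_left_mono)
      then have "(dist (z k) (z n))\<^sup>2 < e\<^sup>2"
        using near[of k n] N by linarith
      then show ?thesis using e by (simp add: power2_less_imp_less)
    qed
    then show "\<exists>M. \<forall>k\<ge>M. \<forall>n\<ge>M. dist (z k) (z n) < e" by blast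
  qed
  then obtain p where p: "z \<longlonglongrightarrow> p"
    using Cauchy_convergent convergent_def by blast
  have pS: "p \<in> S" using closed_sequentially[OF cl _ p] zS by blast
  have "(\<lambda>n. E (z n)) \<longlonglongrightarrow> E p"
    unfolding E_def by (intro tendsto_intros p \<phi>.tendsto)
  moreover have "(\<lambda>n. m + 1 / Suc n) \<longlonglongrightarrow> m + 0"
    using LIMSEQ_inverse_real_of_nat by (intro tendsto_intros) (simp add: inverse_eq_divide)
  ultimately have Ep: "E p \<le> m"
    using z by (intro LIMSEQ_le[of "\<lambda>n. E (z n)"]) (auto intro: less_imp_le)
  have "\<phi> v = inner p v" if v: "v \<in> S" for v
  proof (rule ccontr)
    assume ne: "\<phi> v \<noteq> inner p v"
    define d where "d = \<phi> v - inner p v"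
    have "v \<noteq> 0" using ne by (auto simp: \<phi>.zero)
    then have vv: "inner v v > 0" by simp
    define t where "t = d / inner v v"
    have "E (p + t *\<^sub>R v) = E p - 2 * t * d + t\<^sup>2 * inner v v"
      by (simp add: E_def d_def \<phi>.add \<phi>.scaleR inner_simps inner_commute power2_eq_square algebra_simps)
    also have "\<dots> = E p - d\<^sup>2 / inner v v"
      using vv by (simp add: t_def power2_eq_square field_simps)
    also have "\<dots> < E p" using vv ne by (simp add: d_def)
    finally show False
      using m_le[of "p + t *\<^sub>R v"] Ep subspace_add[OF S pS subspace_scale[OF S v]] by force
  qed
  with pS show ?thesis by (rule that)
qed

lemma orthogonal_projection_exists:
  fixes S :: "'a :: {real_inner, complete_space} set"
  assumes S: "subspace S" and cl: "closed S"
  obtains P where "bounded_linear P" and "\<And>x. P x \<in> S" and "\<And>x. x \<in> S \<Longrightarrow> P x = x"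
    and "\<And>x v. v \<in> S \<Longrightarrow> inner (P x) v = inner x v" and "\<And>x. norm (P x) \<le> norm x"
proof -
  have "\<exists>z\<in>S. \<forall>v\<in>S. inner x v = inner z v" for x
    by (rule riesz_on_closed_subspace[OF bounded_linear_inner_right[of x] S cl]) blast
  then obtain P where PS: "\<And>x. P x \<in> S" and P: "\<And>x v. v \<in> S \<Longrightarrow> inner (P x) v = inner x v"
    by metis
  have unique: "P x = y" if "y \<in> S" "\<And>v. v \<in> S \<Longrightarrow> inner y v = inner x v" for x y
  proof -
    have "inner (P x - y) v = 0" if "v \<in> S" for v
      using that P \<open>\<And>v. v \<in> S \<Longrightarrow> inner y v = inner x v\<close> by (simp add: inner_diff_left)
    then have "inner (P x - y) (P x - y) = 0"
      using subspace_diff[OF S PS \<open>y \<in> S\<close>] by blast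
    then show ?thesis by simp
  qed
  have norm: "norm (P x) \<le> norm x" for x
  proof -
    have "norm (P x) * norm (P x) = inner x (P x)"
      using P[OF PS, of x x] by (metis power2_norm_eq_inner power2_eq_square)
    also have "\<dots> \<le> norm x * norm (P x)" by (rule norm_cauchy_schwarz)
    finally show ?thesis by (cases "P x = 0") auto
  qed
  show ?thesis
  proof
    show "bounded_linear P"
    proof (rule bounded_linear_intro[where K = 1])
      show "P (x + y) = P x + P y" for x y
        by (rule unique) (auto simp: subspace_add[OF S] PS P inner_add_left)
      show "P (c *\<^sub>R x) = c *\<^sub>R P x" for c x
        by (rule unique) (auto simp: subspace_scale[OF S] PS P)
    qed (simp add: norm)
    show "P x = x" if "x \<in> S" for x by (rule unique) (use that in auto)
  qed (fact PS P norm)+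
qed

lemma adjoint_exists:
  fixes A :: "'a :: {real_inner, complete_space} \<Rightarrow> 'b :: real_inner"
  assumes A: "bounded_linear A"
  obtains A' where "\<And>x y. inner (A x) y = inner x (A' y)"
proof -
  have "\<exists>z. \<forall>x. inner (A x) y = inner x z" for y
  proof -
    have "bounded_linear (\<lambda>x. inner (A x) y)"
      using bounded_linear_compose[OF bounded_linear_inner_left A] .
    then show ?thesis
      by (rule riesz_on_closed_subspace[OF _ subspace_UNIV closed_UNIV]) (auto simp: inner_commute)
  qed
  then show ?thesis using that by metis
qed

lemma dense_if_orthogonal_trivial:
  fixes S :: "'a :: {real_inner, complete_space} set"
  assumes S: "subspace S" and triv: "\<And>x. (\<And>v. v \<in> S \<Longrightarrow> inner x v = 0) \<Longrightarrow> x = 0"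
  shows "closure S = UNIV"
proof -
  obtain P where P: "\<And>x. P x \<in> closure S" "\<And>x v. v \<in> closure S \<Longrightarrow> inner (P x) v = inner x v"
    using orthogonal_projection_exists[OF subspace_closure[OF S] closed_closure] by metis
  have "x - P x = 0" for x
    by (rule triv) (use closure_subset[of S] P(2)[of _ x] in \<open>auto simp: inner_diff_left\<close>)
  then show ?thesis using P(1) by (metis UNIV_eq_I eq_iff_diff_eq_0)
qed

section \<open>Operators prescribed on a family of vectors\<close>

text \<open>The index set may be infinite: the kernels below are indexed by all lists of vectors of a given
  length.\<close>

definition psd_kernel :: "'i set \<Rightarrow> ('i \<Rightarrow> 'i \<Rightarrow> real) \<Rightarrow> bool" where
  "psd_kernel I K \<longleftrightarrow> (\<forall>F c. finite F \<longrightarrow> F \<subseteq> I \<longrightarrow> 0 \<le> (\<Sum>k\<in>F. \<Sum>l\<in>F. c k * c l * K k l))"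

lemma psd_kernelD:
  "psd_kernel I K \<Longrightarrow> finite F \<Longrightarrow> F \<subseteq> I \<Longrightarrow> 0 \<le> (\<Sum>k\<in>F. \<Sum>l\<in>F. c k * c l * K k l)"
  by (simp add: psd_kernel_def)

lemma psd_kernel_add:
  "psd_kernel I K \<Longrightarrow> psd_kernel I L \<Longrightarrow> psd_kernel I (\<lambda>k l. K k l + L k l)"
  by (simp add: psd_kernel_def distrib_left sum.distrib)

lemma psd_kernel_cong:
  assumes "psd_kernel I K" and "\<And>k l. k \<in> I \<Longrightarrow> l \<in> I \<Longrightarrow> K k l = L k l"
  shows "psd_kernel I L"
  unfolding psd_kernel_def
proof (intro allI impI)
  fix F c assume F: "finite F" "F \<subseteq> I"
  have "(\<Sum>k\<in>F. \<Sum>l\<in>F. c k * c l * L k l) = (\<Sum>k\<in>F. \<Sum>l\<in>F. c k * c l * K k l)"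
    using F assms(2) by (intro sum.cong) (auto simp: subset_iff)
  then show "0 \<le> (\<Sum>k\<in>F. \<Sum>l\<in>F. c k * c l * L k l)"
    using psd_kernelD[OF assms(1) F, of c] by simp
qed

lemma psd_kernel_zero: "psd_kernel I (\<lambda>k l. 0)"
  by (simp add: psd_kernel_def)

lemma inner_sum_sum:
  "inner (\<Sum>k\<in>F. c k *\<^sub>R x k) (\<Sum>l\<in>F. c l *\<^sub>R x l) = (\<Sum>k\<in>F. \<Sum>l\<in>F. c k * c l * inner (x k) (x l))"
  unfolding inner_sum_left
  by (simp add: inner_sum_right mult.assoc sum_distrib_left mult.left_commute)

lemma has_sum_finite_sum:
  fixes f :: "'i \<Rightarrow> 'b \<Rightarrow> real"
  assumes "\<And>k. k \<in> F \<Longrightarrow> (f k has_sum s k) B"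
  shows "((\<lambda>b. \<Sum>k\<in>F. f k b) has_sum (\<Sum>k\<in>F. s k)) B"
  using assms by (induction F rule: infinite_finite_induct) (auto intro: has_sum_add)

text \<open>Expanding \<open>inner (v k) (v l)\<close> in an orthonormal basis turns the quadratic form of the product
  kernel into a sum of values of the quadratic form of \<open>K\<close>. This is Schur's product theorem.\<close>

lemma psd_kernel_mult_gram:
  fixes v :: "'i \<Rightarrow> 'a :: {real_inner, complete_space}"
  assumes K: "psd_kernel I K"
  shows "psd_kernel I (\<lambda>k l. K k l * inner (v k) (v l))"
  unfolding psd_kernel_def
proof (intro allI impI)
  fix F :: "'i set" and c assume F: "finite F" "F \<subseteq> I"
  obtain B :: "'a set" where B: "\<And>x y. ((\<lambda>b. inner x b * inner y b) has_sum inner x y) B"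
    using parseval_basis_exists by blast
  have "((\<lambda>b. \<Sum>k\<in>F. \<Sum>l\<in>F. c k * c l * K k l * (inner (v k) b * inner (v l) b)) has_sum
      (\<Sum>k\<in>F. \<Sum>l\<in>F. c k * c l * K k l * inner (v k) (v l))) B"
    by (intro has_sum_finite_sum has_sum_cmult_right B)
  then show "0 \<le> (\<Sum>k\<in>F. \<Sum>l\<in>F. c k * c l * (K k l * inner (v k) (v l)))"
    unfolding mult.assoc[symmetric]
  proof (rule has_sum_nonneg)
    fix b
    have "0 \<le> (\<Sum>k\<in>F. \<Sum>l\<in>F. (c k * inner (v k) b) * (c l * inner (v l) b) * K k l)"
      by (rule psd_kernelD[OF K F])
    then show "0 \<le> (\<Sum>k\<in>F. \<Sum>l\<in>F. c k * c l * K k l * inner (v k) b * inner (v l) b)"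
      by (simp add: mult_ac)
  qed
qed

lemma psd_kernel_mult_gram_prod:
  fixes v :: "nat \<Rightarrow> 'i \<Rightarrow> 'a :: {real_inner, complete_space}"
  assumes "psd_kernel I K"
  shows "psd_kernel I (\<lambda>k l. K k l * (\<Prod>j<n. inner (v j k) (v j l)))"
proof (induction n)
  case (Suc n)
  from psd_kernel_mult_gram[OF this, of "v n"] show ?case by (simp add: mult.assoc)
qed (simp add: assms)

text \<open>A contraction \<open>J\<close> shrinks each factor of a product of Gram kernels, and one factor may be
  replaced at a time.\<close>

lemma psd_kernel_gram_prod_diff:
  fixes v :: "nat \<Rightarrow> 'i \<Rightarrow> 'a :: {real_inner, complete_space}"
    and J :: "'a \<Rightarrow> 'b :: {real_inner, complete_space}"
  assumes J: "linear J" and le: "\<And>x. norm (J x) \<le> norm x"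
  shows "psd_kernel I (\<lambda>k l. (\<Prod>j<n. inner (v j k) (v j l)) - (\<Prod>j<n. inner (J (v j k)) (J (v j l))))"
proof (induction n)
  case 0
  then show ?case by (simp add: psd_kernel_def)
next
  case (Suc n)
  let ?D = "\<lambda>k l. inner (v n k) (v n l) - inner (J (v n k)) (J (v n l))"
  have D: "psd_kernel I ?D"
    unfolding psd_kernel_def
  proof (intro allI impI)
    fix F :: "'i set" and c
    let ?x = "\<Sum>k\<in>F. c k *\<^sub>R v n k"
    have Jx: "J ?x = (\<Sum>k\<in>F. c k *\<^sub>R J (v n k))"
      using J by (simp add: linear_sum linear_scale)
    have "(norm (J ?x))\<^sup>2 \<le> (norm ?x)\<^sup>2" by (simp add: le power_mono)
    then show "0 \<le> (\<Sum>k\<in>F. \<Sum>l\<in>F. c k * c l * ?D k l)"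
      unfolding power2_norm_eq_inner Jx inner_sum_sum
      by (simp add: right_diff_distrib sum_subtractf)
  qed
  have "psd_kernel I (\<lambda>k l. ((\<Prod>j<n. inner (v j k) (v j l)) - (\<Prod>j<n. inner (J (v j k)) (J (v j l)))) *
       inner (v n k) (v n l) + ?D k l * (\<Prod>j<n. inner (J (v j k)) (J (v j l))))"
    by (intro psd_kernel_add psd_kernel_mult_gram[OF Suc.IH]
          psd_kernel_mult_gram_prod[OF D, where v = "\<lambda>j k. J (v j k)"])
  then show ?case by (simp add: algebra_simps)
qed

text \<open>The closed span \<open>\<Gamma>\<close> of the pairs \<open>(e k, f k)\<close> satisfies \<open>\<parallel>y\<parallel> \<le> C \<parallel>x\<parallel>\<close> for
  \<open>(x, y) \<in> \<Gamma>\<close>, so it is the graph of a bounded operator on a closed subspace, which is extended by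
  the orthogonal projection.\<close>

lemma operator_from_gram_bound:
  fixes e :: "'i \<Rightarrow> 'a :: {real_inner, complete_space}"
    and f :: "'i \<Rightarrow> 'b :: {real_inner, complete_space}"
  assumes C: "C \<ge> 0"
    and psd: "psd_kernel I (\<lambda>k l. C\<^sup>2 * inner (e k) (e l) - inner (f k) (f l))"
  obtains A where "bounded_linear A" and "\<And>k. k \<in> I \<Longrightarrow> A (e k) = f k"
    and "\<And>x. norm (A x) \<le> C * norm x"
proof -
  define \<Gamma> where "\<Gamma> = closure (span ((\<lambda>k. (e k, f k)) ` I))"
  have sub: "subspace \<Gamma>" unfolding \<Gamma>_def by (intro subspace_closure subspace_span)
  have closed: "closed \<Gamma>" by (simp add: \<Gamma>_def)
  have gen: "(e k, f k) \<in> \<Gamma>" if "k \<in> I" for k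
    unfolding \<Gamma>_def using that closure_subset span_superset by fast
  have "span ((\<lambda>k. (e k, f k)) ` I) \<subseteq> {p. norm (snd p) \<le> C * norm (fst p)}"
  proof
    fix p assume "p \<in> span ((\<lambda>k. (e k, f k)) ` I)"
    then obtain T c where T: "finite T" "T \<subseteq> (\<lambda>k. (e k, f k)) ` I" and p: "p = (\<Sum>a\<in>T. c a *\<^sub>R a)"
      unfolding span_explicit by blast
    then obtain F where F: "F \<subseteq> I" "inj_on (\<lambda>k. (e k, f k)) F" "T = (\<lambda>k. (e k, f k)) ` F"
      unfolding subset_image_inj by blast
    then have fin: "finite F" using T(1) finite_imageD by blast
    define d where "d k = c (e k, f k)" for k
    have p': "p = (\<Sum>k\<in>F. d k *\<^sub>R (e k, f k))"
      unfolding p F(3) d_def by (subst sum.reindex[OF F(2)]) simp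
    have fp: "fst p = (\<Sum>k\<in>F. d k *\<^sub>R e k)" "snd p = (\<Sum>k\<in>F. d k *\<^sub>R f k)"
      unfolding p' by (simp_all add: fst_sum snd_sum)
    have "0 \<le> (\<Sum>k\<in>F. \<Sum>l\<in>F. d k * d l * (C\<^sup>2 * inner (e k) (e l) - inner (f k) (f l)))"
      by (rule psd_kernelD[OF psd fin F(1)])
    also have "\<dots> = C\<^sup>2 * (\<Sum>k\<in>F. \<Sum>l\<in>F. d k * d l * inner (e k) (e l))
        - (\<Sum>k\<in>F. \<Sum>l\<in>F. d k * d l * inner (f k) (f l))"
      by (simp add: right_diff_distrib sum_subtractf sum_distrib_left mult.left_commute)
    also have "\<dots> = C\<^sup>2 * (norm (fst p))\<^sup>2 - (norm (snd p))\<^sup>2"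
      unfolding fp power2_norm_eq_inner inner_sum_sum ..
    finally have "(norm (snd p))\<^sup>2 \<le> (C * norm (fst p))\<^sup>2" by (simp only: power_mult_distrib diff_ge_0_iff_ge)
    then show "p \<in> {p. norm (snd p) \<le> C * norm (fst p)}"
      using C by (auto intro: power2_le_imp_le)
  qed
  then have "\<Gamma> \<subseteq> {p. norm (snd p) \<le> C * norm (fst p)}"
    unfolding \<Gamma>_def
    by (rule closure_minimal) (intro closed_Collect_le continuous_intros)
  then have bound: "norm y \<le> C * norm x" if "(x, y) \<in> \<Gamma>" for x y using that by auto
  have diff: "(x - x', y - y') \<in> \<Gamma>" if "(x, y) \<in> \<Gamma>" "(x', y') \<in> \<Gamma>" for x x' y y'
    using subspace_diff[OF sub that] by simp
  have unique: "y = y'" if "(x, y) \<in> \<Gamma>" "(x, y') \<in> \<Gamma>" for x y y'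
    using bound[OF diff[OF that]] by simp
  define T where "T = fst ` \<Gamma>"
  have subT: "subspace T"
    unfolding T_def using sub by (rule linear_subspace_image[OF linear_fst])
  have "closed T"
    unfolding closed_sequential_limits
  proof (intro allI impI, elim conjE)
    fix u l assume "\<forall>n. u n \<in> T" and u: "u \<longlonglongrightarrow> l"
    then have "\<forall>n. \<exists>w. (u n, w) \<in> \<Gamma>" by (force simp: T_def)
    then obtain w where w: "\<And>n. (u n, w n) \<in> \<Gamma>" by metis
    have "Cauchy w"
    proof (rule metric_CauchyI)
      fix \<epsilon> :: real assume \<epsilon>: "\<epsilon> > 0"
      then obtain N where N: "\<And>m n. m \<ge> N \<Longrightarrow> n \<ge> N \<Longrightarrow> dist (u m) (u n) < \<epsilon> / (C + 1)"
        using metric_CauchyD[OF LIMSEQ_imp_Cauchy[OF u], of "\<epsilon> / (C + 1)"] C by auto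
      have "dist (w m) (w n) < \<epsilon>" if "m \<ge> N" "n \<ge> N" for m n
      proof -
        have "dist (w m) (w n) \<le> C * dist (u m) (u n)"
          using bound[OF diff[OF w w]] by (simp add: dist_norm)
        also have "\<dots> \<le> (C + 1) * dist (u m) (u n)" by (simp add: mult_right_mono)
        also have "\<dots> < \<epsilon>" using N[OF that] C by (simp add: field_simps)
        finally show ?thesis .
      qed
      then show "\<exists>M. \<forall>m\<ge>M. \<forall>n\<ge>M. dist (w m) (w n) < \<epsilon>" by blast
    qed
    then obtain z where "w \<longlonglongrightarrow> z" using Cauchy_convergent convergent_def by blast
    then have "(\<lambda>n. (u n, w n)) \<longlonglongrightarrow> (l, z)" using u by (intro tendsto_Pair)
    then have "(l, z) \<in> \<Gamma>" using closed_sequentially[OF closed, of "\<lambda>n. (u n, w n)"] w by blast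
    then show "l \<in> T" by (force simp: T_def)
  qed
  then obtain P where P: "bounded_linear P" "\<And>x. P x \<in> T" "\<And>x. x \<in> T \<Longrightarrow> P x = x"
      "\<And>x. norm (P x) \<le> norm x"
    using orthogonal_projection_exists[OF subT] by metis
  have "\<exists>y. (P x, y) \<in> \<Gamma>" for x using P(2)[of x] by (force simp: T_def)
  then obtain A where A: "\<And>x. (P x, A x) \<in> \<Gamma>" by metis
  interpret P: bounded_linear P by fact
  have norm_A: "norm (A x) \<le> C * norm x" for x
    using bound[OF A] mult_left_mono[OF P(4) C] order_trans by blast
  show ?thesis
  proof
    show "bounded_linear A"
    proof (rule bounded_linear_intro[where K = C])
      show "A (x + y) = A x + A y" for x y
        using unique[OF A[of "x + y"]] subspace_add[OF sub A A] by (simp add: P.add)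
      show "A (c *\<^sub>R x) = c *\<^sub>R A x" for c x
        using unique[OF A[of "c *\<^sub>R x"]] subspace_scale[OF sub A] by (simp add: P.scaleR)
    qed (simp add: norm_A mult.commute)
    show "A (e k) = f k" if "k \<in> I" for k
    proof -
      have "e k \<in> T" using gen[OF that] by (force simp: T_def)
      then show ?thesis using unique[OF A[of "e k"]] gen[OF that] P(3) by auto
    qed
  qed (fact norm_A)
qed

section \<open>Operators on tensor powers\<close>

lemma subspace_tensor_power: "subspace (tensor_power n)"
  unfolding tensor_power_def by (intro subspace_closure subspace_span)

lemma closed_tensor_power: "closed (tensor_power n)"
  by (simp add: tensor_power_def)

lemma etens_in_tensor_power: "length xs = n \<Longrightarrow> etens xs \<in> tensor_power n"
  unfolding tensor_power_def using closure_subset span_superset by fast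

lemma tensor_power_eqI:
  assumes "bounded_linear A" and "bounded_linear B"
    and "\<And>xs. length xs = n \<Longrightarrow> A (etens xs) = B (etens xs)" and "f \<in> tensor_power n"
  shows "A f = B f"
proof (rule bounded_linear_eq_on_closure_span[OF assms(1,2)])
  show "f \<in> closure (span {etens xs | xs. length xs = n})"
    using assms(4) by (simp add: tensor_power_def)
qed (use assms(3) in auto)

lemma tensor_power_image_subset:
  assumes A: "bounded_linear A" and S: "subspace S" "closed S"
    and gen: "\<And>xs. length xs = n \<Longrightarrow> A (etens xs) \<in> S" and f: "f \<in> tensor_power n"
  shows "A f \<in> S"
proof -
  have "subspace (A -` S)"
    using bounded_linear.linear[OF A] S(1) by (rule linear_subspace_vimage)
  moreover have "closed (A -` S)"
    using bounded_linear.continuous_on[OF A continuous_on_id] S(2) by (auto intro: closed_vimage)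
  ultimately have "tensor_power n \<subseteq> A -` S"
    unfolding tensor_power_def using gen by (intro closure_minimal span_minimal) auto
  then show ?thesis using f by auto
qed

lemma inner_etens_prod_list:
  "length xs = length ys \<Longrightarrow> inner (etens xs) (etens ys) = prod_list (map2 inner xs ys)"
  by (simp add: inner_etens prod.list_conv_set_nth lessThan_atLeast0)

lemma inner_etens_append:
  assumes "length xs = length xs'" and "length ys = length ys'"
  shows "inner (etens (xs @ ys)) (etens (xs' @ ys')) =
    inner (etens xs) (etens xs') * inner (etens ys) (etens ys')"
  using assms by (simp add: inner_etens_prod_list)

lemma tensor_extend_bounded_linear:
  assumes "bounded_linear A" and "\<And>xs. length xs = n \<Longrightarrow> A (etens xs) = \<phi> xs"
  shows "bounded_linear (tensor_extend n \<phi>)"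
    and "length xs = n \<Longrightarrow> tensor_extend n \<phi> (etens xs) = \<phi> xs"
    and "f \<in> tensor_power n \<Longrightarrow> tensor_extend n \<phi> f = A f"
proof -
  have *: "bounded_linear (tensor_extend n \<phi>) \<and>
      (\<forall>xs. length xs = n \<longrightarrow> tensor_extend n \<phi> (etens xs) = \<phi> xs)"
    unfolding tensor_extend_def by (rule someI[of _ A]) (use assms in auto)
  then show "bounded_linear (tensor_extend n \<phi>)"
    and "length xs = n \<Longrightarrow> tensor_extend n \<phi> (etens xs) = \<phi> xs" by auto
  show "tensor_extend n \<phi> f = A f" if "f \<in> tensor_power n"
    by (rule tensor_power_eqI[OF _ assms(1) _ that]) (use * assms(2) in auto)
qed

text \<open>The Gram kernel of elementary tensors is a product of \<open>n\<close> Gram kernels, one for each factor, and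
  Schur's product theorem compares these products for the vectors and for their images.\<close>

lemma contraction_tensor_power:
  fixes J :: "'a :: {real_inner, complete_space} \<Rightarrow> 'b :: {real_inner, complete_space}"
  assumes J: "linear J" "\<And>x. norm (J x) \<le> norm x"
  obtains A where "bounded_linear A" and "\<And>xs. length xs = n \<Longrightarrow> A (etens xs) = etens (map J xs)"
    and "\<And>x. norm (A x) \<le> norm x"
proof -
  have psd: "psd_kernel {xs :: 'a list. length xs = n}
      (\<lambda>xs ys. 1\<^sup>2 * inner (etens xs) (etens ys) - inner (etens (map J xs)) (etens (map J ys)))"
    by (rule psd_kernel_cong[OF psd_kernel_gram_prod_diff[OF J, where v = "\<lambda>j xs. xs ! j" and n = n]])
       (auto simp: inner_etens)
  obtain A where A: "bounded_linear A"
      "\<And>xs. xs \<in> {xs :: 'a list. length xs = n} \<Longrightarrow> A (etens xs) = etens (map J xs)"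
      "\<And>x. norm (A x) \<le> 1 * norm x"
    by (rule operator_from_gram_bound[OF _ psd]) auto
  show ?thesis by (rule that[of A]) (use A in auto)
qed

context
  fixes J :: "'a :: {real_inner, complete_space} \<Rightarrow> 'b :: {real_inner, complete_space}"
  assumes J: "linear J" "\<And>x. norm (J x) \<le> norm x"
begin

lemma bounded_linear_tensor_map: "bounded_linear (tensor_map n J)"
  and tensor_map_etens: "length xs = n \<Longrightarrow> tensor_map n J (etens xs) = etens (map J xs)"
  and norm_tensor_map_le: "f \<in> tensor_power n \<Longrightarrow> norm (tensor_map n J f) \<le> norm f"
proof -
  obtain A where A: "bounded_linear A" "\<And>xs. length xs = n \<Longrightarrow> A (etens xs) = etens (map J xs)"
    "\<And>x. norm (A x) \<le> norm x"
    using contraction_tensor_power[OF J, of n] by blast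
  note T = tensor_extend_bounded_linear[of A n "\<lambda>xs. etens (map J xs)", OF A(1,2), folded tensor_map_def]
  show "bounded_linear (tensor_map n J)"
    "length xs = n \<Longrightarrow> tensor_map n J (etens xs) = etens (map J xs)"
    "f \<in> tensor_power n \<Longrightarrow> norm (tensor_map n J f) \<le> norm f"
    using T A(3) by auto
qed

lemma tensor_map_in_tensor_power:
  "f \<in> tensor_power n \<Longrightarrow> tensor_map n J f \<in> tensor_power n"
  by (rule tensor_power_image_subset[OF bounded_linear_tensor_map subspace_tensor_power closed_tensor_power])
     (auto simp: tensor_map_etens etens_in_tensor_power)

end

text \<open>Elementary tensors depend continuously on their factors, since their inner products do.\<close>

lemma tensor_power_subset_closure_span:
  fixes D :: "'a :: {real_inner, complete_space} set"
  assumes D: "closure D = UNIV"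
  shows "tensor_power n \<subseteq> closure (span {etens xs | xs. length xs = n \<and> set xs \<subseteq> D})"
    (is "_ \<subseteq> closure (span ?E)")
proof -
  have "\<exists>u. (\<forall>k. u k \<in> D) \<and> u \<longlonglongrightarrow> x" for x
    using D unfolding closure_sequential[symmetric] by auto
  then obtain u where uD: "\<And>x k. u x k \<in> D" and u: "\<And>x. u x \<longlonglongrightarrow> x" by metis
  have "etens xs \<in> closure (span ?E)" if n: "length xs = n" for xs
  proof -
    define us where "us k = map (\<lambda>x. u x k) xs" for k
    have len: "length (us k) = n" for k by (simp add: us_def n)
    have nth: "(\<lambda>k. us k ! i) \<longlonglongrightarrow> xs ! i" if "i < n" for i
      using that u by (simp add: us_def n)
    have "(\<lambda>k. inner (etens (us k)) (etens (us k)) - 2 * inner (etens (us k)) (etens xs)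
        + inner (etens xs) (etens xs)) \<longlonglongrightarrow>
        inner (etens xs) (etens xs) - 2 * inner (etens xs) (etens xs) + inner (etens xs) (etens xs)"
      by (simp only: inner_etens len n refl if_True) (intro tendsto_intros nth; simp)
    moreover have "inner (etens (us k)) (etens (us k)) - 2 * inner (etens (us k)) (etens xs)
        + inner (etens xs) (etens xs) = (dist (etens (us k)) (etens xs))\<^sup>2" for k
      unfolding dist_norm power2_norm_eq_inner
      by (simp add: inner_diff_left inner_diff_right inner_commute)
    ultimately have "(\<lambda>k. (dist (etens (us k)) (etens xs))\<^sup>2) \<longlonglongrightarrow> 0" by simp
    from tendsto_real_sqrt[OF this] have "(\<lambda>k. etens (us k)) \<longlonglongrightarrow> etens xs"
      by (subst tendsto_dist_iff) simp
    moreover have "etens (us k) \<in> span ?E" for k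
    proof (rule span_base, intro CollectI exI conjI)
      show "set (us k) \<subseteq> D" using uD by (auto simp: us_def)
    qed (rule refl len)+
    ultimately show ?thesis
      unfolding closure_sequential by (intro exI[of _ "\<lambda>k. etens (us k)"]) simp
  qed
  then show ?thesis
    unfolding tensor_power_def by (intro closure_minimal span_minimal subspace_closure subspace_span) auto
qed

lemma tensor_map_approximates:
  fixes J :: "'a :: {real_inner, complete_space} \<Rightarrow> 'b :: {real_inner, complete_space}"
  assumes J: "linear J" "\<And>x. norm (J x) \<le> norm x" and dense: "closure (range J) = UNIV"
    and g: "g \<in> tensor_power n" and e: "e > 0"
  obtains f where "f \<in> tensor_power n" and "norm (g - tensor_map n J f) < e"
proof -
  let ?X = "{etens xs | xs :: 'a list. length xs = n}"
  interpret bounded_linear "tensor_map n J" by (rule bounded_linear_tensor_map[OF J])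
  have "{etens ys | ys. length ys = n \<and> set ys \<subseteq> range J} \<subseteq> tensor_map n J ` ?X"
  proof clarify
    fix ys assume "n = length ys" "set ys \<subseteq> range J"
    then have "ys = map J (map (inv J) ys)"
      by (auto simp: map_idI f_inv_into_f subset_iff)
    then have "etens ys = tensor_map n J (etens (map (inv J) ys))"
      using \<open>n = length ys\<close> by (simp add: tensor_map_etens[OF J])
    moreover have "etens (map (inv J) ys) \<in> {etens xs | xs :: 'a list. length xs = length ys}"
      by (intro CollectI exI[of _ "map (inv J) ys"]) simp
    ultimately show "etens ys \<in> tensor_map (length ys) J ` {etens xs | xs :: 'a list. length xs = length ys}"
      using \<open>n = length ys\<close> by blast
  qed
  then have "tensor_power n \<subseteq> closure (span (tensor_map n J ` ?X))"
    by (intro order_trans[OF tensor_power_subset_closure_span[OF dense]] closure_mono span_mono)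
  also have "span (tensor_map n J ` ?X) = tensor_map n J ` span ?X"
    by (rule linear_span_image[OF linear_axioms])
  finally obtain h where h: "h \<in> tensor_map n J ` span ?X" "dist h g < e"
    using g e by (meson closure_approachable subsetD)
  then obtain f where "f \<in> span ?X" "h = tensor_map n J f" by blast
  moreover have "span ?X \<subseteq> tensor_power n" unfolding tensor_power_def by (rule closure_subset)
  ultimately show ?thesis using that[of f] h by (auto simp: dist_norm norm_minus_commute)
qed

text \<open>If \<open>f\<close> is killed by \<open>J\<^sup>\<otimes>\<^sup>n\<close>, then it is orthogonal to all elementary tensors with factors in
  the range of the adjoint of \<open>J\<close>. That range is dense because \<open>J\<close> is injective.\<close>

lemma inj_on_tensor_map:
  fixes J :: "'a :: {real_inner, complete_space} \<Rightarrow> 'b :: {real_inner, complete_space}"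
  assumes J: "linear J" "\<And>x. norm (J x) \<le> norm x" and inj: "inj J"
  shows "inj_on (tensor_map n J) (tensor_power n)"
proof -
  interpret T: bounded_linear "tensor_map n J" by (rule bounded_linear_tensor_map[OF J])
  have "bounded_linear J"
    using J by (intro bounded_linear_intro[where K = 1]) (auto simp: linear_add linear_scale)
  then obtain J' where J': "\<And>x y. inner (J x) y = inner x (J' y)"
    using adjoint_exists[of J] by blast
  have lin: "linear J'"
  proof (rule linearI)
    show "J' (x + y) = J' x + J' y" for x y
      by (subst vector_eq_ldot[symmetric]) (simp add: J'[symmetric] inner_add_right)
    show "J' (c *\<^sub>R x) = c *\<^sub>R J' x" for c x
      by (subst vector_eq_ldot[symmetric]) (simp add: J'[symmetric])
  qed
  have dense: "closure (range J') = UNIV"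
  proof (rule dense_if_orthogonal_trivial)
    show "subspace (range J')" by (rule linear_subspace_image[OF lin subspace_UNIV])
    fix x assume orth: "\<And>v. v \<in> range J' \<Longrightarrow> inner x v = 0"
    have "inner (J x) (J x) = 0" unfolding J' by (rule orth) simp
    then have "J x = J 0" using J(1) by (simp add: linear_0)
    then show "x = 0" using inj by (simp add: inj_eq)
  qed
  have zero: "f = 0" if f: "f \<in> tensor_power n" and Tf: "tensor_map n J f = 0" for f
  proof -
    have adj: "inner (etens (map J' ys)) f = inner (etens ys) (tensor_map n J f)"
      if "length ys = n" for ys
    proof (rule tensor_power_eqI[OF _ _ _ f])
      show "bounded_linear (inner (etens (map J' ys)))" by (rule bounded_linear_inner_right)
      show "bounded_linear (\<lambda>f. inner (etens ys) (tensor_map n J f))"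
        by (rule bounded_linear_compose[OF bounded_linear_inner_right T.bounded_linear_axioms])
      show "inner (etens (map J' ys)) (etens xs) = inner (etens ys) (tensor_map n J (etens xs))"
        if "length xs = n" for xs
        using that \<open>length ys = n\<close>
        by (simp add: tensor_map_etens[OF J] inner_etens J'[symmetric] inner_commute[of "J' _"]
            inner_commute[of "ys ! _"])
    qed
    have "inner f f = 0"
    proof (rule bounded_linear_eq_on_closure_span[where A = "inner f" and B = "\<lambda>_. 0"])
      show "bounded_linear (inner f)" by (rule bounded_linear_inner_right)
      show "bounded_linear (\<lambda>_. 0 :: real)" by (rule bounded_linear_zero)
      show "f \<in> closure (span {etens xs | xs. length xs = n \<and> set xs \<subseteq> range J'})"
        using tensor_power_subset_closure_span[OF dense] f by blast
      fix h assume "h \<in> {etens xs | xs. length xs = n \<and> set xs \<subseteq> range J'}"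
      then obtain xs where xs: "h = etens xs" "length xs = n" "set xs \<subseteq> range J'" by blast
      then have "map J' (map (inv J') xs) = xs"
        by (auto intro!: map_idI simp: f_inv_into_f subset_iff)
      then show "inner f h = 0"
        using adj[of "map (inv J') xs"] xs Tf by (simp add: inner_commute)
    qed
    then show ?thesis by simp
  qed
  show ?thesis
  proof (rule inj_onI)
    fix f g assume fg: "f \<in> tensor_power n" "g \<in> tensor_power n" "tensor_map n J f = tensor_map n J g"
    have "f - g = 0"
      by (rule zero) (use fg in \<open>auto simp: T.diff intro: subspace_diff[OF subspace_tensor_power]\<close>)
    then show "f = g" by simp
  qed
qed


section \<open>The tensor product of two tensor powers\<close>

text \<open>The product is built one variable at a time. For fixed factors \<open>xs\<close>, the map
  \<open>etens ys \<mapsto> etens (xs @ ys)\<close> scales the Gram kernel by \<open>\<parallel>etens xs\<parallel>\<^sup>2\<close> and extends to an operator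
  \<open>R xs\<close>. For fixed \<open>g\<close>, the map \<open>etens xs \<mapsto> R xs g\<close> scales the Gram kernel by \<open>\<parallel>g\<parallel>\<^sup>2\<close> and extends
  to an operator \<open>A g\<close>, which is determined on the tensor power only. Composing with orthogonal
  projections in both variables makes the product bilinear on the whole ambient space.\<close>

lemma tensor_mult_exists:
  "\<exists>m :: 'a :: {real_inner, complete_space} list ell2 \<Rightarrow> 'a list ell2 \<Rightarrow> 'a list ell2.
     bounded_bilinear m \<and>
     (\<forall>xs ys. length xs = i \<longrightarrow> length ys = j \<longrightarrow> m (etens xs) (etens ys) = etens (xs @ ys))"
proof -
  have "\<exists>R. bounded_linear R \<and> (\<forall>ys. length ys = j \<longrightarrow> R (etens ys) = etens (xs @ ys))" for xs :: "'a list"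
  proof -
    have psd: "psd_kernel {ys :: 'a list. length ys = j}
      (\<lambda>ys ys'. (norm (etens xs))\<^sup>2 * inner (etens ys) (etens ys') - inner (etens (xs @ ys)) (etens (xs @ ys')))"
      by (rule psd_kernel_cong[OF psd_kernel_zero]) (auto simp: inner_etens_append power2_norm_eq_inner)
    show ?thesis by (rule operator_from_gram_bound[OF _ psd]) auto
  qed
  then obtain R where R: "\<And>xs :: 'a list. bounded_linear (R xs)"
    and R_etens: "\<And>xs ys. length ys = j \<Longrightarrow> R xs (etens ys) = etens (xs @ ys)" by metis
  have inner_R: "inner (R xs g) (R xs' g') = inner (etens xs) (etens xs') * inner g g'"
    if xs: "length xs = i" "length xs' = i" and g: "g \<in> tensor_power j" "g' \<in> tensor_power j"
    for xs xs' g g'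
  proof -
    have *: "inner (R xs g) (R xs' (etens ys)) = inner (etens xs) (etens xs') * inner g (etens ys)"
      if ys: "length ys = j" for ys
    proof (rule tensor_power_eqI[OF _ _ _ g(1)])
      show "bounded_linear (\<lambda>g. inner (R xs g) (R xs' (etens ys)))"
        by (rule bounded_linear_compose[OF bounded_linear_inner_left R])
      show "bounded_linear (\<lambda>g. inner (etens xs) (etens xs') * inner g (etens ys))"
        by (rule bounded_linear_compose[OF bounded_linear_mult_right bounded_linear_inner_left])
    qed (use xs ys in \<open>auto simp: R_etens inner_etens_append\<close>)
    show ?thesis
    proof (rule tensor_power_eqI[OF _ _ _ g(2)])
      show "bounded_linear (\<lambda>g'. inner (R xs g) (R xs' g'))"
        by (rule bounded_linear_compose[OF bounded_linear_inner_right R])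
      show "bounded_linear (\<lambda>g'. inner (etens xs) (etens xs') * inner g g')"
        by (rule bounded_linear_compose[OF bounded_linear_mult_right bounded_linear_inner_right])
    qed (rule *)
  qed
  have "\<exists>A. bounded_linear A \<and> (\<forall>xs. length xs = i \<longrightarrow> A (etens xs) = R xs g) \<and>
      (\<forall>f. norm (A f) \<le> norm g * norm f)" if g: "g \<in> tensor_power j" for g
  proof -
    have psd: "psd_kernel {xs :: 'a list. length xs = i}
        (\<lambda>xs xs'. (norm g)\<^sup>2 * inner (etens xs) (etens xs') - inner (R xs g) (R xs' g))"
      by (rule psd_kernel_cong[OF psd_kernel_zero]) (auto simp: inner_R g power2_norm_eq_inner)
    show ?thesis by (rule operator_from_gram_bound[OF _ psd]) auto
  qed
  then obtain A where A: "\<And>g. g \<in> tensor_power j \<Longrightarrow> bounded_linear (A g)"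
    and A_etens: "\<And>g xs. g \<in> tensor_power j \<Longrightarrow> length xs = i \<Longrightarrow> A g (etens xs) = R xs g"
    and A_norm: "\<And>g f. g \<in> tensor_power j \<Longrightarrow> norm (A g f) \<le> norm g * norm f"
    by metis
  obtain P :: "'a list ell2 \<Rightarrow> 'a list ell2" where P: "bounded_linear P" "\<And>x. P x \<in> tensor_power i"
      "\<And>x. x \<in> tensor_power i \<Longrightarrow> P x = x" "\<And>x. norm (P x) \<le> norm x"
    by (rule orthogonal_projection_exists[OF subspace_tensor_power closed_tensor_power]) blast
  obtain Q :: "'a list ell2 \<Rightarrow> 'a list ell2" where Q: "bounded_linear Q" "\<And>x. Q x \<in> tensor_power j"
      "\<And>x. x \<in> tensor_power j \<Longrightarrow> Q x = x" "\<And>x. norm (Q x) \<le> norm x"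
    by (rule orthogonal_projection_exists[OF subspace_tensor_power closed_tensor_power]) blast
  interpret P: bounded_linear P by fact
  interpret Q: bounded_linear Q by fact
  have A_add: "A (g + g') f = A g f + A g' f"
    if g: "g \<in> tensor_power j" "g' \<in> tensor_power j" and f: "f \<in> tensor_power i" for g g' f
    by (rule tensor_power_eqI[OF _ _ _ f])
       (use g subspace_add[OF subspace_tensor_power g] in
        \<open>auto simp: A_etens linear_add bounded_linear.linear[OF R] intro: A bounded_linear_add\<close>)
  have A_scale: "A (c *\<^sub>R g) f = c *\<^sub>R A g f"
    if g: "g \<in> tensor_power j" and f: "f \<in> tensor_power i" for c g f
    by (rule tensor_power_eqI[OF _ _ _ f])
       (use g subspace_scale[OF subspace_tensor_power g] in
        \<open>auto simp: A_etens linear_scale bounded_linear.linear[OF R]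
          intro: A bounded_linear_compose[OF bounded_linear_scaleR_right]\<close>)
  define m where "m f g = A (Q g) (P f)" for f g
  have "bounded_bilinear m"
  proof
    show "m (f + f') g = m f g + m f' g" for f f' g
      using A[OF Q(2)[of g]] by (simp add: m_def P.add linear_add bounded_linear.linear)
    show "m f (g + g') = m f g + m f g'" for f g g'
      by (simp add: m_def Q.add A_add P(2) Q(2))
    show "m (c *\<^sub>R f) g = c *\<^sub>R m f g" for c f g
      using A[OF Q(2)[of g]] by (simp add: m_def P.scaleR linear_scale bounded_linear.linear)
    show "m f (c *\<^sub>R g) = c *\<^sub>R m f g" for c f g
      by (simp add: m_def Q.scaleR A_scale P(2) Q(2))
    have "norm (m f g) \<le> norm f * norm g * 1" for f g
    proof -
      have "norm (m f g) \<le> norm (Q g) * norm (P f)" unfolding m_def by (rule A_norm[OF Q(2)])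
      also have "\<dots> \<le> norm g * norm f" by (intro mult_mono P(4) Q(4)) auto
      finally show ?thesis by (simp add: mult.commute)
    qed
    then show "\<exists>K. \<forall>f g. norm (m f g) \<le> norm f * norm g * K" by blast
  qed
  moreover have "m (etens xs) (etens ys) = etens (xs @ ys)" if "length xs = i" "length ys = j" for xs ys
    using that by (simp add: m_def P(3) Q(3) A_etens R_etens etens_in_tensor_power)
  ultimately show ?thesis by blast
qed

lemma bounded_bilinear_tensor_mult: "bounded_bilinear (tensor_mult i j)"
  and tensor_mult_etens: "length xs = i \<Longrightarrow> length ys = j \<Longrightarrow>
    tensor_mult i j (etens xs) (etens ys) = etens (xs @ ys)"
  using someI_ex[OF tensor_mult_exists[of i j], folded tensor_mult_def] by blast+

lemmas bounded_linear_tensor_mult =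
  bounded_linear_compose[OF bounded_bilinear.bounded_linear_left[OF bounded_bilinear_tensor_mult]]
  bounded_linear_compose[OF bounded_bilinear.bounded_linear_right[OF bounded_bilinear_tensor_mult]]

lemma tensor_mult_in_tensor_power:
  assumes f: "f \<in> tensor_power i" and g: "g \<in> tensor_power j"
  shows "tensor_mult i j f g \<in> tensor_power (i + j)"
proof (rule tensor_power_image_subset[where A = "\<lambda>f. tensor_mult i j f g",
      OF _ subspace_tensor_power closed_tensor_power _ f])
  show "tensor_mult i j (etens xs) g \<in> tensor_power (i + j)" if xs: "length xs = i" for xs
    by (rule tensor_power_image_subset[where A = "tensor_mult i j (etens xs)",
          OF _ subspace_tensor_power closed_tensor_power _ g])
       (auto simp: tensor_mult_etens xs etens_in_tensor_power intro: bounded_linear_tensor_mult bounded_linear_ident)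
qed (intro bounded_linear_tensor_mult bounded_linear_ident)

text \<open>The product multiplies inner products of elementary tensors, and by continuity all inner products;
  the four arguments pass from elementary tensors to general ones in turn.\<close>

lemma norm_tensor_mult:
  assumes f: "f \<in> tensor_power i" and g: "g \<in> tensor_power j"
  shows "norm (tensor_mult i j f g) = norm f * norm g"
proof -
  let ?m = "tensor_mult i j"
  note inner_lin = bounded_linear_compose[OF bounded_linear_inner_left]
    bounded_linear_compose[OF bounded_linear_inner_right]
    bounded_linear_compose[OF bounded_linear_mult_left] bounded_linear_compose[OF bounded_linear_mult_right]
    bounded_linear_tensor_mult bounded_linear_ident bounded_linear_inner_left bounded_linear_inner_right
  have 1: "inner (?m f (etens ys)) (?m (etens xs') (etens ys')) =
      inner f (etens xs') * inner (etens ys) (etens ys')"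
    if "length ys = j" "length xs' = i" "length ys' = j" for ys xs' ys'
  proof (rule tensor_power_eqI[OF _ _ _ f])
  qed ((intro inner_lin)+, use that in \<open>simp add: tensor_mult_etens inner_etens_append\<close>)
  have 2: "inner (?m f g) (?m (etens xs') (etens ys')) = inner f (etens xs') * inner g (etens ys')"
    if "length xs' = i" "length ys' = j" for xs' ys'
  proof (rule tensor_power_eqI[OF _ _ _ g])
  qed ((intro inner_lin)+, use that in \<open>simp add: 1\<close>)
  have 3: "inner (?m f g) (?m f' (etens ys')) = inner f f' * inner g (etens ys')"
    if "length ys' = j" and f': "f' \<in> tensor_power i" for f' ys'
  proof (rule tensor_power_eqI[OF _ _ _ f'])
  qed ((intro inner_lin)+, use that in \<open>simp add: 2\<close>)
  have "inner (?m f g) (?m f g') = inner f f * inner g g'" if g': "g' \<in> tensor_power j" for g'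
  proof (rule tensor_power_eqI[OF _ _ _ g'])
  qed ((intro inner_lin)+, simp add: 3 f)
  from this[OF g] have "(norm (?m f g))\<^sup>2 = (norm f * norm g)\<^sup>2"
    by (simp add: power2_norm_eq_inner power_mult_distrib)
  then show ?thesis by (rule power2_eq_imp_eq) auto
qed

lemma tensor_mult_assoc:
  assumes f: "f \<in> tensor_power i" and g: "g \<in> tensor_power j" and h: "h \<in> tensor_power k"
  shows "tensor_mult (i + j) k (tensor_mult i j f g) h = tensor_mult i (j + k) f (tensor_mult j k g h)"
proof -
  have 1: "tensor_mult (i + j) k (tensor_mult i j f (etens ys)) (etens zs) =
      tensor_mult i (j + k) f (tensor_mult j k (etens ys) (etens zs))"
    if "length ys = j" "length zs = k" for ys zs
  proof (rule tensor_power_eqI[OF _ _ _ f])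
  qed ((intro bounded_linear_tensor_mult bounded_linear_ident)+,
      use that in \<open>simp add: tensor_mult_etens\<close>)
  have 2: "tensor_mult (i + j) k (tensor_mult i j f g) (etens zs) =
      tensor_mult i (j + k) f (tensor_mult j k g (etens zs))" if "length zs = k" for zs
  proof (rule tensor_power_eqI[OF _ _ _ g])
  qed ((intro bounded_linear_tensor_mult bounded_linear_ident)+, use that in \<open>simp add: 1\<close>)
  show ?thesis
  proof (rule tensor_power_eqI[OF _ _ _ h])
  qed ((intro bounded_linear_tensor_mult bounded_linear_ident)+, simp add: 2)
qed

section \<open>The operators defining the q-Fock norm\<close>

text \<open>The entry at \<open>i\<close> of the Lehmer code of \<open>\<pi>\<close>: the inversions whose left end is \<open>i\<close>.\<close>

definition lehmer :: "nat \<Rightarrow> (nat \<Rightarrow> nat) \<Rightarrow> nat \<Rightarrow> nat" where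
  "lehmer n \<pi> i = card {j. i < j \<and> j < n \<and> \<pi> j < \<pi> i}"

lemma inversions_eq_sum_lehmer: "inversions n \<pi> = (\<Sum>i<n. lehmer n \<pi> i)"
proof -
  have "{(i, j). i < j \<and> j < n \<and> \<pi> i > \<pi> j} = Sigma {..<n} (\<lambda>i. {j. i < j \<and> j < n \<and> \<pi> j < \<pi> i})"
    by auto
  then show ?thesis by (simp add: inversions_def lehmer_def card_SigmaI)
qed

lemma lehmer_less: "i < n \<Longrightarrow> lehmer n \<pi> i < n"
proof -
  assume "i < n"
  have "card {j. i < j \<and> j < n \<and> \<pi> j < \<pi> i} \<le> card {i<..<n}" by (rule card_mono) auto
  then show ?thesis using \<open>i < n\<close> by (simp add: lehmer_def)
qed

text \<open>The entry at \<open>i\<close> counts the values below \<open>\<pi> i\<close> that are not taken before \<open>i\<close>. It therefore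
  determines \<open>\<pi> i\<close> once the earlier values are known, and the code determines \<open>\<pi>\<close>.\<close>

lemma lehmer_eq_card:
  assumes \<pi>: "\<pi> permutes {..<n}" and i: "i < n"
  shows "lehmer n \<pi> i = card ({..<\<pi> i} - \<pi> ` {..<i})"
proof -
  have "\<pi> ` {j. i < j \<and> j < n \<and> \<pi> j < \<pi> i} = {..<\<pi> i} - \<pi> ` {..<i}"
  proof (intro subset_antisym subsetI)
    fix y assume "y \<in> \<pi> ` {j. i < j \<and> j < n \<and> \<pi> j < \<pi> i}"
    then show "y \<in> {..<\<pi> i} - \<pi> ` {..<i}"
      using permutes_inj[OF \<pi>] by (auto simp: inj_eq)
  next
    fix y assume y: "y \<in> {..<\<pi> i} - \<pi> ` {..<i}"
    have "\<pi> i < n" using permutes_in_image[OF \<pi>, of i] i by auto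
    then have "y \<in> \<pi> ` {..<n}" using y permutes_image[OF \<pi>] by auto
    then obtain j where j: "j < n" "y = \<pi> j" by auto
    then have "\<not> j < i" "j \<noteq> i" using y by auto
    then show "y \<in> \<pi> ` {j. i < j \<and> j < n \<and> \<pi> j < \<pi> i}" using y j by auto
  qed
  moreover have "inj_on \<pi> {j. i < j \<and> j < n \<and> \<pi> j < \<pi> i}"
    using permutes_inj[OF \<pi>] inj_on_subset by blast
  ultimately show ?thesis using card_image by (fastforce simp: lehmer_def)
qed

lemma lehmer_strict_mono:
  assumes \<pi>: "\<pi> permutes {..<n}" and \<sigma>: "\<sigma> permutes {..<n}" and i: "i < n"
    and eq: "\<And>j. j < i \<Longrightarrow> \<pi> j = \<sigma> j" and less: "\<pi> i < \<sigma> i"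
  shows "lehmer n \<pi> i < lehmer n \<sigma> i"
proof -
  have img: "\<sigma> ` {..<i} = \<pi> ` {..<i}" using eq by auto
  have "\<pi> i \<notin> \<pi> ` {..<i}" using permutes_inj[OF \<pi>] by (auto simp: inj_eq)
  then have "{..<\<pi> i} - \<pi> ` {..<i} \<subset> {..<\<sigma> i} - \<pi> ` {..<i}" using less by auto
  then show ?thesis
    unfolding lehmer_eq_card[OF \<pi> i] lehmer_eq_card[OF \<sigma> i] img
    by (intro psubset_card_mono) auto
qed

lemma lehmer_injective:
  assumes \<pi>: "\<pi> permutes {..<n}" and \<sigma>: "\<sigma> permutes {..<n}"
    and eq: "\<And>i. i < n \<Longrightarrow> lehmer n \<pi> i = lehmer n \<sigma> i"
  shows "\<pi> = \<sigma>"
proof -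
  have "i < n \<Longrightarrow> \<pi> i = \<sigma> i" for i
  proof (induction i rule: less_induct)
    case (less i)
    then have "\<pi> j = \<sigma> j" if "j < i" for j using that by auto
    then show ?case
      using lehmer_strict_mono[OF \<pi> \<sigma> less.prems] lehmer_strict_mono[OF \<sigma> \<pi> less.prems]
        eq[OF less.prems] by (metis less_irrefl linorder_neqE_nat)
  qed
  then show ?thesis
    using permutes_not_in[OF \<pi>] permutes_not_in[OF \<sigma>] by (metis ext lessThan_iff)
qed

text \<open>The sum equals \<open>[n]\<^sub>p!\<close>. For the upper bound it suffices that Lehmer codes embed the permutations
  into the functions from \<open>{..<n}\<close> to itself: the sum of \<open>\<Prod>i<n. p ^ c i\<close> over all such \<open>c\<close>
  is a product of partial sums of the geometric series.\<close>

lemma sum_power_inversions_le: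
  fixes p :: real
  assumes p: "0 \<le> p" "p < 1"
  shows "(\<Sum>\<pi> | \<pi> permutes {..<n}. p ^ inversions n \<pi>) \<le> (1 / (1 - p)) ^ n"
proof -
  let ?S = "{\<pi>. \<pi> permutes {..<n}}" and ?code = "\<lambda>\<pi>. restrict (lehmer n \<pi>) {..<n}"
  have inj: "inj_on ?code ?S"
    by (rule inj_onI) (metis lehmer_injective lessThan_iff mem_Collect_eq restrict_apply')
  have "(\<Sum>\<pi>\<in>?S. p ^ inversions n \<pi>) = (\<Sum>\<pi>\<in>?S. \<Prod>i<n. p ^ ?code \<pi> i)"
    by (simp add: inversions_eq_sum_lehmer power_sum)
  also have "\<dots> = (\<Sum>c\<in>?code ` ?S. \<Prod>i<n. p ^ c i)"
    by (simp only: sum.reindex[OF inj] o_def)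
  also have "\<dots> \<le> (\<Sum>c\<in>{..<n} \<rightarrow>\<^sub>E {..<n}. \<Prod>i<n. p ^ c i)"
  proof (rule sum_mono2)
    show "?code ` ?S \<subseteq> {..<n} \<rightarrow>\<^sub>E {..<n}"
      by (auto simp del: restrict_apply intro!: restrict_PiE_iff[THEN iffD2] lehmer_less)
  qed (use p in \<open>auto intro!: finite_PiE prod_nonneg\<close>)
  also have "\<dots> = (\<Prod>i<n. \<Sum>c<n. p ^ c)"
    by (subst prod_sum_PiE) auto
  also have "\<dots> \<le> (\<Prod>i<n. 1 / (1 - p))"
  proof (rule prod_mono)
    have "(\<Sum>c<n. p ^ c) \<le> (\<Sum>c. p ^ c)"
      using p by (intro sum_le_suminf summable_geometric) auto
    then show "0 \<le> (\<Sum>c<n. p ^ c) \<and> (\<Sum>c<n. p ^ c) \<le> 1 / (1 - p)" for i :: nat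
      using p by (auto simp: suminf_geometric intro: sum_nonneg)
  qed
  finally show ?thesis by simp
qed

lemma permutation_operator_exists:
  assumes \<pi>: "\<pi> permutes {..<n}"
  shows "\<exists>U :: 'a :: {real_inner, complete_space} list ell2 \<Rightarrow> 'a list ell2. bounded_linear U \<and>
    (\<forall>xs. length xs = n \<longrightarrow> U (etens xs) = etens (map (\<lambda>i. xs ! \<pi> i) [0..<n])) \<and>
    (\<forall>x. norm (U x) \<le> norm x)"
proof -
  have "inner (etens (map (\<lambda>i. xs ! \<pi> i) [0..<n])) (etens (map (\<lambda>i. ys ! \<pi> i) [0..<n])) =
      inner (etens xs) (etens ys)" if "length xs = n" "length ys = n" for xs ys :: "'a list"
    using that prod.permute[OF \<pi>, of "\<lambda>i. inner (xs ! i) (ys ! i)"] by (simp add: inner_etens)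
  then have psd: "psd_kernel {xs :: 'a list. length xs = n} (\<lambda>xs ys. 1\<^sup>2 * inner (etens xs) (etens ys) -
      inner (etens (map (\<lambda>i. xs ! \<pi> i) [0..<n])) (etens (map (\<lambda>i. ys ! \<pi> i) [0..<n])))"
    by (intro psd_kernel_cong[OF psd_kernel_zero]) auto
  show ?thesis by (rule operator_from_gram_bound[OF _ psd]) auto
qed

lemma
  fixes f :: "'a :: {real_inner, complete_space} list ell2"
  shows bounded_linear_q_operator:
      "bounded_linear (q_operator q n :: 'a list ell2 \<Rightarrow> 'a list ell2)"
    and norm_q_operator_le: "\<bar>q\<bar> < 1 \<Longrightarrow> f \<in> tensor_power n \<Longrightarrow>
    norm (q_operator q n f) \<le> (1 / (1 - \<bar>q\<bar>)) ^ n * norm f"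
proof -
  have "\<forall>\<pi>. \<exists>U. \<pi> permutes {..<n} \<longrightarrow> bounded_linear U \<and>
      (\<forall>xs. length xs = n \<longrightarrow> U (etens xs) = etens (map (\<lambda>i. xs ! \<pi> i) [0..<n] :: 'a list)) \<and>
      (\<forall>x. norm (U x) \<le> norm x)"
    using permutation_operator_exists by blast
  from choice[OF this] obtain U where U: "\<And>\<pi>. \<pi> permutes {..<n} \<Longrightarrow> bounded_linear (U \<pi>)"
    "\<And>\<pi> xs. \<pi> permutes {..<n} \<Longrightarrow> length xs = n \<Longrightarrow>
      U \<pi> (etens xs) = etens (map (\<lambda>i. xs ! \<pi> i) [0..<n] :: 'a list)"
    "\<And>\<pi> x. \<pi> permutes {..<n} \<Longrightarrow> norm (U \<pi> x) \<le> norm x"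
    by blast
  define A where "A x = (\<Sum>\<pi> | \<pi> permutes {..<n}. q ^ inversions n \<pi> *\<^sub>R U \<pi> x)" for x
  have A: "bounded_linear A"
    unfolding A_def
    by (intro bounded_linear_sum bounded_linear_compose[OF bounded_linear_scaleR_right] U) auto
  have A_etens: "A (etens xs) =
      (\<Sum>\<pi> | \<pi> permutes {..<n}. q ^ inversions n \<pi> *\<^sub>R etens (map (\<lambda>i. xs ! \<pi> i) [0..<n]))"
    if "length xs = n" for xs
    unfolding A_def using that by (intro sum.cong) (auto simp: U)
  show "bounded_linear (q_operator q n :: 'a list ell2 \<Rightarrow> 'a list ell2)" 
    unfolding q_operator_def by (rule tensor_extend_bounded_linear(1)[OF A A_etens])
  show "norm (q_operator q n f) \<le> (1 / (1 - \<bar>q\<bar>)) ^ n * norm f" if q: "\<bar>q\<bar> < 1" and f: "f \<in> tensor_power n"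
  proof -
    have "norm (A f) \<le> (\<Sum>\<pi> | \<pi> permutes {..<n}. \<bar>q\<bar> ^ inversions n \<pi> * norm f)"
      unfolding A_def by (rule sum_norm_le) (auto simp: power_abs intro!: mult_left_mono U)
    also have "\<dots> \<le> (1 / (1 - \<bar>q\<bar>)) ^ n * norm f"
      unfolding sum_distrib_right[symmetric] using q by (intro mult_right_mono sum_power_inversions_le) auto
    also have "A f = q_operator q n f"
      unfolding q_operator_def by (rule tensor_extend_bounded_linear(3)[OF A A_etens f, symmetric])
    finally show ?thesis .
  qed
qed

section \<open>Growth of the q-factorials\<close>

text \<open>Up to the factor \<open>(1 - q)\<^sup>n\<close> the q-factorial is a partial product of the infinite product of
  the factors \<open>1 - q\<^sup>k\<close>, which converges to a nonzero limit.\<close>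

lemma q_fact_two_sided_bound:
  assumes q: "\<bar>q\<bar> < 1"
  obtains c C where "c > 0" and "\<And>n. c \<le> q_fact q n * (1 - q) ^ n" and "\<And>n. q_fact q n * (1 - q) ^ n \<le> C"
proof -
  define a where "a n = (\<Prod>k<n. 1 + - (q ^ Suc k))" for n
  have q_fact: "q_fact q n * (1 - q) ^ n = a n" for n
  proof (induction n)
    case (Suc n)
    have "q_int q (Suc n) * (1 - q) = 1 - q ^ Suc n"
      using q unfolding q_int_def sum_gp_strict by (simp del: power_Suc)
    then show ?case using Suc by (simp add: q_fact_def a_def mult_ac)
  qed (simp add: q_fact_def a_def)
  have pow: "\<bar>q ^ Suc k\<bar> < 1" for k
    using q mult_left_mono[OF power_le_one[of "\<bar>q\<bar>" k], of "\<bar>q\<bar>"] by (simp add: abs_mult power_abs)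
  have pos: "a n > 0" for n
    unfolding a_def by (intro prod_pos) (use pow in \<open>auto simp: abs_less_iff\<close>)
  have "summable (\<lambda>k. norm (- (q ^ Suc k)))"
    using summable_geometric[of "\<bar>q\<bar>"] q by (simp add: power_abs abs_mult summable_mult)
  moreover have neq: "- (q ^ Suc k) \<noteq> - 1" for k using pow[of k] by auto
  ultimately have "convergent_prod (\<lambda>k. 1 + - (q ^ Suc k))"
    by (intro summable_imp_convergent_prod_real) auto
  moreover have "1 + - (q ^ Suc k) \<noteq> 0" for k using neq[of k] by simp
  ultimately obtain L where L: "a \<longlonglongrightarrow> L" "L \<noteq> 0"
    unfolding a_def LIMSEQ_lessThan_iff_atMost[where f = "\<lambda>S. \<Prod>k\<in>S. 1 + - (q ^ Suc k)"]
    by (metis convergent_prod_iff_nz_lim)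
  obtain C where C: "\<And>n. norm (a n) \<le> C"
    using convergent_imp_Bseq[of a] L(1) by (auto simp: convergent_def Bseq_def)
  obtain K where K: "K > 0" "\<And>n. norm (inverse (a n)) \<le> K"
    using convergent_imp_Bseq[of "\<lambda>n. inverse (a n)"] tendsto_inverse[OF L]
    by (auto simp: convergent_def Bseq_def)
  show ?thesis
  proof
    show "inverse K > 0" using K by simp
    show "inverse K \<le> q_fact q n * (1 - q) ^ n" for n
      using K(1) K(2)[of n] pos[of n] le_imp_inverse_le[of "inverse (a n)" K] by (simp add: q_fact)
    show "q_fact q n * (1 - q) ^ n \<le> C" for n
      using C[of n] by (simp add: q_fact abs_le_iff)
  qed
qed

lemma q_fact_pos: "\<bar>q\<bar> < 1 \<Longrightarrow> q_fact q n > 0"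
  by (rule q_fact_two_sided_bound[of q])
     (auto, metis abs_less_iff diff_gt_0_iff_gt less_le_trans zero_less_mult_pos2 zero_less_power)

text \<open>The q-binomial coefficients are bounded.\<close>

lemma q_fact_powr_add_le:
  assumes q: "\<bar>q\<bar> < 1" and \<alpha>: "\<alpha> \<ge> 0"
  obtains K where "K > 0"
    and "\<And>i j. q_fact q (i + j) powr \<alpha> \<le> K * (q_fact q i powr \<alpha> * q_fact q j powr \<alpha>)"
proof -
  obtain c C where c: "c > 0" "\<And>n. c \<le> q_fact q n * (1 - q) ^ n" "\<And>n. q_fact q n * (1 - q) ^ n \<le> C"
    by (rule q_fact_two_sided_bound[OF q]) blast
  have C: "C > 0" using c(1) c(2)[of 0] c(3)[of 0] by linarith
  have "q_fact q (i + j) \<le> C / c\<^sup>2 * (q_fact q i * q_fact q j)" for i j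
  proof -
    have pos: "(1 - q) ^ (i + j) > 0" using q by simp
    have "q_fact q (i + j) * (1 - q) ^ (i + j) \<le> C / c\<^sup>2 * (c * c)"
      using c by (simp add: power2_eq_square)
    also have "\<dots> \<le> C / c\<^sup>2 * ((q_fact q i * (1 - q) ^ i) * (q_fact q j * (1 - q) ^ j))"
      using c C by (intro mult_left_mono mult_mono) (auto intro: order_trans[OF less_imp_le])
    also have "\<dots> = C / c\<^sup>2 * (q_fact q i * q_fact q j) * (1 - q) ^ (i + j)"
      by (simp add: power_add mult_ac)
    finally show ?thesis using pos by (simp only: mult_le_cancel_right_pos)
  qed
  then have "q_fact q (i + j) powr \<alpha> \<le> (C / c\<^sup>2 * (q_fact q i * q_fact q j)) powr \<alpha>" for i j
    using \<alpha> q_fact_pos[OF q] by (intro powr_mono2) (auto intro: less_imp_le)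
  moreover have "(C / c\<^sup>2 * (q_fact q i * q_fact q j)) powr \<alpha> =
      (C / c\<^sup>2) powr \<alpha> * (q_fact q i powr \<alpha> * q_fact q j powr \<alpha>)" for i j
    using c C q_fact_pos[OF q] by (subst powr_mult) (auto simp: powr_mult less_imp_le)
  ultimately show ?thesis using that[of "(C / c\<^sup>2) powr \<alpha>"] c C by simp
qed

text \<open>The weights of one of the spaces \<^const>\<open>G_space\<close> dominate any given exponential growth. This will be
  applied to the bound for the operators defining the q-Fock norm.\<close>

lemma power_le_q_fact_powr:
  assumes q: "\<bar>q\<bar> < 1" and \<alpha>: "\<alpha> \<ge> 0" and D: "D > 0"
  obtains r K where "r \<ge> 1" and "K > 0" and "\<And>n. D ^ n \<le> K * (r ^ n * q_fact q n powr \<alpha>)"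
proof -
  obtain c where c: "c > 0" "\<And>n. c \<le> q_fact q n * (1 - q) ^ n"
    using q_fact_two_sided_bound[OF q] by metis
  define t where "t = (1 - q) powr \<alpha>"
  have t: "t > 0" using q by (simp add: t_def)
  have pw: "((1 - q) ^ n) powr \<alpha> = t ^ n" for n
    using q by (induction n) (auto simp: t_def powr_mult)
  show ?thesis
  proof
    \<comment> \<open>The weight \<open>([n]\<^sub>q!)\<^sup>\<alpha>\<close> is at least a constant times \<open>t\<^sup>-\<^sup>n\<close>.\<close>
    show "max 1 (D * t) \<ge> 1" by simp
    show "1 / c powr \<alpha> > 0" using c by simp
    fix n
    have "c powr \<alpha> \<le> (q_fact q n * (1 - q) ^ n) powr \<alpha>"
      using c \<alpha> by (intro powr_mono2) auto
    also have "\<dots> = q_fact q n powr \<alpha> * t ^ n"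
      using q q_fact_pos[OF q] by (simp add: powr_mult pw less_imp_le)
    finally have "D ^ n * c powr \<alpha> \<le> D ^ n * (q_fact q n powr \<alpha> * t ^ n)"
      using D by (intro mult_left_mono) auto
    also have "\<dots> = (D * t) ^ n * q_fact q n powr \<alpha>" by (simp add: power_mult_distrib)
    also have "\<dots> \<le> max 1 (D * t) ^ n * q_fact q n powr \<alpha>"
      using D t by (intro mult_right_mono power_mono) auto
    finally show "D ^ n \<le> 1 / c powr \<alpha> * (max 1 (D * t) ^ n * q_fact q n powr \<alpha>)"
      using c by (simp add: field_simps)
  qed
qed

section \<open>The algebra structure\<close>

lemma Suc_times_power_le:
  fixes r s :: real
  assumes "0 < r" "r < s"
  obtains M where "M > 0" and "\<And>n. real (Suc n) * r ^ n \<le> M * s ^ n"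
proof -
  have x: "norm (r / s) < 1" using assms by simp
  have "(\<lambda>n. of_nat n * (r / s) ^ n + (r / s) ^ n) \<longlonglongrightarrow> 0 + 0"
    by (intro tendsto_add powser_times_n_limit_0[OF x] LIMSEQ_power_zero[OF x])
  then have "Bseq (\<lambda>n. of_nat n * (r / s) ^ n + (r / s) ^ n)"
    by (intro convergent_imp_Bseq convergentI)
  then obtain M where M: "M > 0" "\<And>n. norm (of_nat n * (r / s) ^ n + (r / s) ^ n) \<le> M"
    by (auto simp: Bseq_def)
  have "real (Suc n) * r ^ n \<le> M * s ^ n" for n
  proof -
    have "real (Suc n) * (r / s) ^ n \<le> M"
      using M(2)[of n] assms by (simp add: algebra_simps abs_le_iff)
    then show ?thesis using assms by (simp add: power_divide field_simps)
  qed
  with M(1) show ?thesis by (rule that)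
qed

lemma G_space_tensor_power: "F \<in> G_space q r \<alpha> \<Longrightarrow> F n \<in> tensor_power n"
  by (simp add: G_space_def)

lemma G_lim_tensor_power: "F \<in> G_lim q \<alpha> \<Longrightarrow> F n \<in> tensor_power n"
  unfolding G_lim_def using G_space_tensor_power[of F q 1 \<alpha> n] by auto

lemma G_lim_subset: "r \<ge> 1 \<Longrightarrow> G_lim q \<alpha> \<subseteq> G_space q r \<alpha>"
  by (auto simp: G_lim_def)

lemma G_space_add:
  assumes r: "r \<ge> 0" and F: "F \<in> G_space q r \<alpha>" and G: "G \<in> G_space q r \<alpha>"
  shows "(\<lambda>n. F n + G n) \<in> G_space q r \<alpha>"
proof -
  have "summable (\<lambda>n. (norm (F n + G n))\<^sup>2 * r ^ n * q_fact q n powr \<alpha>)"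
  proof (rule summable_comparison_test')
    show "summable (\<lambda>n. 2 * ((norm (F n))\<^sup>2 * r ^ n * q_fact q n powr \<alpha>) +
        2 * ((norm (G n))\<^sup>2 * r ^ n * q_fact q n powr \<alpha>))"
      using F G by (intro summable_add summable_mult) (auto simp: G_space_def)
    fix n
    have "(norm (F n + G n))\<^sup>2 \<le> (norm (F n) + norm (G n))\<^sup>2"
      by (intro power_mono norm_triangle_ineq) simp
    also have "\<dots> \<le> 2 * (norm (F n))\<^sup>2 + 2 * (norm (G n))\<^sup>2"
      using sum_squares_bound[of "norm (F n)" "norm (G n)"] by (simp add: power2_sum)
    finally have "(norm (F n + G n))\<^sup>2 * (r ^ n * q_fact q n powr \<alpha>) \<le>
        (2 * (norm (F n))\<^sup>2 + 2 * (norm (G n))\<^sup>2) * (r ^ n * q_fact q n powr \<alpha>)"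
      using r by (intro mult_right_mono) auto
    then show "norm ((norm (F n + G n))\<^sup>2 * r ^ n * q_fact q n powr \<alpha>) \<le>
        2 * ((norm (F n))\<^sup>2 * r ^ n * q_fact q n powr \<alpha>) + 2 * ((norm (G n))\<^sup>2 * r ^ n * q_fact q n powr \<alpha>)"
      using r by (simp add: algebra_simps)
  qed
  then show ?thesis
    using F G by (auto simp: G_space_def intro: subspace_add[OF subspace_tensor_power])
qed

lemma G_space_scale:
  assumes F: "F \<in> G_space q r \<alpha>"
  shows "(\<lambda>n. c *\<^sub>R F n) \<in> G_space q r \<alpha>"
proof -
  have "summable (\<lambda>n. c\<^sup>2 * ((norm (F n))\<^sup>2 * r ^ n * q_fact q n powr \<alpha>))"
    using F by (intro summable_mult) (simp add: G_space_def)
  then show ?thesis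
    using F by (auto simp: G_space_def power_mult_distrib mult_ac intro: subspace_scale[OF subspace_tensor_power])
qed

lemma G_space_diff:
  assumes "r \<ge> 0" and "F \<in> G_space q r \<alpha>" and "G \<in> G_space q r \<alpha>"
  shows "(\<lambda>n. F n - G n) \<in> G_space q r \<alpha>"
  using G_space_add[OF assms(1,2) G_space_scale[OF assms(3), of "- 1"]] by simp

lemma seq_tensor_tensor_power:
  assumes "\<And>n. F n \<in> tensor_power n" and "\<And>n. G n \<in> tensor_power n"
  shows "(F \<otimes>\<^sub>s G) n \<in> tensor_power n"
proof -
  have "tensor_mult i (n - i) (F i) (G (n - i)) \<in> tensor_power n" if "i \<le> n" for i
    using tensor_mult_in_tensor_power[OF assms(1)[of i] assms(2)[of "n - i"]] that by simp
  then show ?thesis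
    unfolding seq_tensor_def by (intro subspace_sum[OF subspace_tensor_power]) auto
qed

text \<open>By the Cauchy--Schwarz inequality the square of the norm of the \<open>n\<close>-th component of the product
  is at most \<open>n + 1\<close> times the convolution of the squared norms. The factor \<open>n + 1\<close> is absorbed by
  passing from \<open>r\<close> to \<open>s\<close>, and the weights are submultiplicative up to a constant, so that the
  Cauchy product of series gives the estimate.\<close>

lemma G_space_seq_tensor:
  assumes q: "\<bar>q\<bar> < 1" and \<alpha>: "\<alpha> \<ge> 0" and r: "0 < r" "r < s"
  obtains C where "C > 0" and "\<And>F G :: nat \<Rightarrow> 'a :: {real_inner, complete_space} list ell2.
    F \<in> G_space q s \<alpha> \<Longrightarrow> G \<in> G_space q s \<alpha> \<Longrightarrow>
    F \<otimes>\<^sub>s G \<in> G_space q r \<alpha> \<and> G_norm q r \<alpha> (F \<otimes>\<^sub>s G) \<le> C * G_norm q s \<alpha> F * G_norm q s \<alpha> G"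
proof -
  let ?w = "\<lambda>n. q_fact q n powr \<alpha>"
  obtain K where K: "K > 0" "\<And>i j. ?w (i + j) \<le> K * (?w i * ?w j)"
    using q_fact_powr_add_le[OF q \<alpha>] by blast
  obtain M where M: "M > 0" "\<And>n. real (Suc n) * r ^ n \<le> M * s ^ n"
    using Suc_times_power_le[OF r] by blast
  have main: "F \<otimes>\<^sub>s G \<in> G_space q r \<alpha> \<and>
      G_norm q r \<alpha> (F \<otimes>\<^sub>s G) \<le> sqrt (M * K) * G_norm q s \<alpha> F * G_norm q s \<alpha> G"
    if F: "F \<in> G_space q s \<alpha>" and G: "G \<in> G_space q s \<alpha>"
    for F G :: "nat \<Rightarrow> 'a list ell2"
  proof -
    note Ft = G_space_tensor_power[OF F] and Gt = G_space_tensor_power[OF G]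
    define a where "a n = (norm (F n))\<^sup>2 * s ^ n * ?w n" for n
    define b where "b n = (norm (G n))\<^sup>2 * s ^ n * ?w n" for n
    define t where "t n = (norm ((F \<otimes>\<^sub>s G) n))\<^sup>2 * r ^ n * ?w n" for n
    have ab: "summable a" "summable b" "\<And>n. a n \<ge> 0" "\<And>n. b n \<ge> 0" "\<And>n. t n \<ge> 0"
      using F G r by (auto simp: G_space_def a_def[abs_def] b_def[abs_def] t_def)
    then have conv: "(\<lambda>n. \<Sum>i\<le>n. a i * b (n - i)) sums (suminf a * suminf b)"
      by (intro Cauchy_product_sums) auto
    have t_le: "t n \<le> (M * K) * (\<Sum>i\<le>n. a i * b (n - i))" for n
    proof -
      have "norm ((F \<otimes>\<^sub>s G) n) \<le> (\<Sum>i\<le>n. norm (F i) * norm (G (n - i)))"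
        unfolding seq_tensor_def by (rule sum_norm_le) (simp add: norm_tensor_mult[OF Ft Gt])
      then have "(norm ((F \<otimes>\<^sub>s G) n))\<^sup>2 \<le> (\<Sum>i\<le>n. norm (F i) * norm (G (n - i)))\<^sup>2"
        by (intro power_mono) auto
      also have "\<dots> \<le> (\<Sum>i\<le>n. (norm (F i) * norm (G (n - i)))\<^sup>2) * card {..n}"
        by (rule sum_squared_le_sum_of_squares)
      finally have "t n \<le> (\<Sum>i\<le>n. (norm (F i) * norm (G (n - i)))\<^sup>2) * real (Suc n) * (r ^ n * ?w n)"
        unfolding t_def mult.assoc[of "_\<^sup>2" "r ^ n"] using r by (intro mult_right_mono) auto
      also have "\<dots> = (\<Sum>i\<le>n. (norm (F i) * norm (G (n - i)))\<^sup>2 * (real (Suc n) * r ^ n * ?w n))"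
        by (simp only: sum_distrib_right[symmetric] mult.assoc)
      also have "\<dots> \<le> (\<Sum>i\<le>n. (M * K) * (a i * b (n - i)))"
      proof (rule sum_mono)
        fix i assume "i \<in> {..n}"
        then have n: "n = i + (n - i)" by simp
        have "real (Suc n) * r ^ n * ?w n \<le> (M * s ^ n) * (K * (?w i * ?w (n - i)))"
          using r M K(2)[of i "n - i"] n by (intro mult_mono[OF M(2)]) auto
        also have "\<dots> = (M * K) * ((s ^ i * ?w i) * (s ^ (n - i) * ?w (n - i)))"
          by (subst n, subst power_add) (simp add: mult_ac)
        finally have "(norm (F i) * norm (G (n - i)))\<^sup>2 * (real (Suc n) * r ^ n * ?w n) \<le>
            (norm (F i) * norm (G (n - i)))\<^sup>2 * ((M * K) * ((s ^ i * ?w i) * (s ^ (n - i) * ?w (n - i))))"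
          by (rule mult_left_mono) simp
        then show "(norm (F i) * norm (G (n - i)))\<^sup>2 * (real (Suc n) * r ^ n * ?w n) \<le>
            (M * K) * (a i * b (n - i))"
          by (simp add: a_def b_def power_mult_distrib mult_ac)
      qed
      finally show ?thesis by (simp add: sum_distrib_left)
    qed
    have st: "summable t"
      by (rule summable_comparison_test'[OF summable_mult[OF sums_summable[OF conv], of "M * K"]])
         (use t_le ab(5) in auto)
    have "suminf t \<le> (\<Sum>n. (M * K) * (\<Sum>i\<le>n. a i * b (n - i)))"
      by (intro suminf_le t_le st summable_mult sums_summable[OF conv])
    also have "\<dots> = (M * K) * (suminf a * suminf b)"
      using conv by (simp add: suminf_mult sums_iff)
    finally have "sqrt (suminf t) \<le> sqrt ((M * K) * (suminf a * suminf b))" by simp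
    then have "G_norm q r \<alpha> (F \<otimes>\<^sub>s G) \<le> sqrt (M * K) * G_norm q s \<alpha> F * G_norm q s \<alpha> G"
      by (simp add: G_norm_def real_sqrt_mult t_def[abs_def] a_def[abs_def] b_def[abs_def] mult.assoc)
    moreover have "F \<otimes>\<^sub>s G \<in> G_space q r \<alpha>"
      using st seq_tensor_tensor_power[of F G, OF Ft Gt] by (simp add: G_space_def t_def[abs_def])
    ultimately show ?thesis by blast
  qed
  show ?thesis by (rule that[of "sqrt (M * K)"]) (use K(1) M(1) main in auto)
qed

text \<open>Both triple products are the sum of \<open>F i \<otimes> G j \<otimes> H k\<close> over \<open>i + j + k = n\<close>.\<close>

lemma seq_tensor_assoc:
  assumes F: "\<And>n. F n \<in> tensor_power n" and G: "\<And>n. G n \<in> tensor_power n" and H: "\<And>n. H n \<in> tensor_power n"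
  shows "(F \<otimes>\<^sub>s G) \<otimes>\<^sub>s H = F \<otimes>\<^sub>s (G \<otimes>\<^sub>s H)"
proof
  fix n
  note sum_left = bounded_bilinear.sum_left[OF bounded_bilinear_tensor_mult]
    and sum_right = bounded_bilinear.sum_right[OF bounded_bilinear_tensor_mult]
  let ?f = "\<lambda>i j k. tensor_mult i (j + k) (F i) (tensor_mult j k (G j) (H k))"
  have "((F \<otimes>\<^sub>s G) \<otimes>\<^sub>s H) n = (\<Sum>j=0..n. \<Sum>i=0..j. ?f i (j - i) (n - j))"
    unfolding seq_tensor_def atMost_atLeast0
  proof (intro sum.cong refl)
    fix j assume "j \<in> {0..n}"
    have "tensor_mult j (n - j) (tensor_mult i (j - i) (F i) (G (j - i))) (H (n - j)) = ?f i (j - i) (n - j)"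
      if "i \<in> {0..j}" for i
      using tensor_mult_assoc[OF F[of i] G[of "j - i"] H[of "n - j"]] that by simp
    then show "tensor_mult j (n - j) (\<Sum>i=0..j. tensor_mult i (j - i) (F i) (G (j - i))) (H (n - j)) =
        (\<Sum>i=0..j. ?f i (j - i) (n - j))"
      unfolding sum_left by (intro sum.cong refl)
  qed
  also have "\<dots> = (\<Sum>j=0..n. \<Sum>i=0..n - j. ?f j i (n - j - i))"
    by (rule fps_mult_assoc_lemma)
  also have "\<dots> = (F \<otimes>\<^sub>s (G \<otimes>\<^sub>s H)) n"
    unfolding seq_tensor_def atMost_atLeast0 sum_right by (intro sum.cong refl) simp
  finally show "((F \<otimes>\<^sub>s G) \<otimes>\<^sub>s H) n = (F \<otimes>\<^sub>s (G \<otimes>\<^sub>s H)) n" .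
qed

lemma tensor_algebra_on_G_lim:
  assumes q: "\<bar>q\<bar> < 1" and \<alpha>: "\<alpha> \<ge> 0"
  shows "tensor_algebra_on (G_lim q \<alpha> :: (nat \<Rightarrow> 'a :: {real_inner, complete_space} list ell2) set)"
  unfolding tensor_algebra_on_def
proof (intro conjI ballI allI)
  note bilinear = bounded_bilinear_tensor_mult
  fix F G H :: "nat \<Rightarrow> 'a list ell2" and c :: real
  show "(\<lambda>_. 0) \<in> (G_lim q \<alpha> :: (nat \<Rightarrow> 'a list ell2) set)"
    by (simp add: G_lim_def G_space_def subspace_0[OF subspace_tensor_power])
  show "(F \<oplus>\<^sub>s G) \<otimes>\<^sub>s H = (F \<otimes>\<^sub>s H) \<oplus>\<^sub>s (G \<otimes>\<^sub>s H)" "F \<otimes>\<^sub>s (G \<oplus>\<^sub>s H) = (F \<otimes>\<^sub>s G) \<oplus>\<^sub>s (F \<otimes>\<^sub>s H)"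
    "(c \<odot>\<^sub>s F) \<otimes>\<^sub>s G = c \<odot>\<^sub>s (F \<otimes>\<^sub>s G)" "F \<otimes>\<^sub>s (c \<odot>\<^sub>s G) = c \<odot>\<^sub>s (F \<otimes>\<^sub>s G)"
    unfolding seq_tensor_def seq_add_def seq_scale_def
    by (simp_all add: bounded_bilinear.add_left[OF bilinear] bounded_bilinear.add_right[OF bilinear]
        bounded_bilinear.scaleR_left[OF bilinear] bounded_bilinear.scaleR_right[OF bilinear]
        sum.distrib scaleR_sum_right)
  assume F: "F \<in> G_lim q \<alpha>"
  show "c \<odot>\<^sub>s F \<in> G_lim q \<alpha>"
    using F by (auto simp: G_lim_def seq_scale_def intro: G_space_scale)
  assume G: "G \<in> G_lim q \<alpha>"
  show "F \<oplus>\<^sub>s G \<in> G_lim q \<alpha>"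
    using F G by (auto simp: G_lim_def seq_add_def intro: G_space_add)
  show "F \<otimes>\<^sub>s G \<in> G_lim q \<alpha>"
    unfolding G_lim_def
  proof
    fix r :: real assume "r \<in> {1..}"
    then have r: "0 < r" "r < r + 1" "1 \<le> r + 1" by auto
    from r(3) have "F \<in> G_space q (r + 1) \<alpha>" "G \<in> G_space q (r + 1) \<alpha>"
      using F G G_lim_subset by blast+
    then show "F \<otimes>\<^sub>s G \<in> G_space q r \<alpha>"
      by (rule_tac G_space_seq_tensor[OF q \<alpha> r(1,2), where 'a = 'a]) blast
  qed
  assume H: "H \<in> G_lim q \<alpha>"
  show "(F \<otimes>\<^sub>s G) \<otimes>\<^sub>s H = F \<otimes>\<^sub>s (G \<otimes>\<^sub>s H)"
    by (intro seq_tensor_assoc G_lim_tensor_power[OF F] G_lim_tensor_power[OF G] G_lim_tensor_power[OF H])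
qed

section \<open>The embedding into the q-Fock space\<close>

lemma topspace_norm_topology: "topspace (norm_topology S \<nu>) = S"
proof (rule subset_antisym)
  show "topspace (norm_topology S \<nu>) \<subseteq> S"
    using openin_topspace[of "norm_topology S \<nu>"] unfolding openin_norm_topology by blast
  have "openin (norm_topology S \<nu>) S"
    unfolding openin_norm_topology by (auto intro: exI[of _ 1])
  then show "S \<subseteq> topspace (norm_topology S \<nu>)" by (rule openin_subset)
qed

lemma abs_q_operator_form_le:
  assumes q: "\<bar>q\<bar> < 1" and f: "f \<in> tensor_power n"
  shows "\<bar>inner (q_operator q n f) f\<bar> \<le> (1 / (1 - \<bar>q\<bar>)) ^ n * (norm f)\<^sup>2"
proof -
  have "\<bar>inner (q_operator q n f) f\<bar> \<le> norm (q_operator q n f) * norm f"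
    by (rule Cauchy_Schwarz_ineq2)
  also have "\<dots> \<le> (1 / (1 - \<bar>q\<bar>)) ^ n * norm f * norm f"
    by (intro mult_right_mono norm_q_operator_le q f) simp
  finally show ?thesis by (simp add: power2_eq_square mult.assoc)
qed

locale contractive_embedding =
  fixes J :: "'p :: {real_inner, complete_space} \<Rightarrow> 'h :: {real_inner, complete_space}"
    and q \<alpha> :: real
  assumes J_linear: "linear J" and J_norm: "norm (J x) \<le> norm x"
    and q: "\<bar>q\<bar> < 1" and \<alpha>: "\<alpha> \<ge> 0"
begin

lemma tensor_map_linear: "linear (tensor_map n J)"
  using bounded_linear_tensor_map[OF J_linear J_norm] by (rule bounded_linear.linear)

lemma fock_embedding_diff:
  "fock_embedding J (\<lambda>n. F n - G n) = (\<lambda>n. fock_embedding J F n - fock_embedding J G n)"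
  by (simp add: fock_embedding_def linear_diff[OF tensor_map_linear])

text \<open>Both an exponential growth of the norms of the operators \<open>P\<^sub>q\<^sup>(\<^sup>n\<^sup>)\<close> and a possible exponential decay of
  the weights \<open>([n]\<^sub>q!)\<^sup>\<alpha>\<close> for negative \<open>q\<close> are absorbed by a large \<open>r\<close>.\<close>

lemma fock_embedding_bounded:
  obtains r K where "r \<ge> 1" and "K > 0"
    and "\<And>F. F \<in> G_space q r \<alpha> \<Longrightarrow>
      fock_embedding J F \<in> fock_space q \<and> fock_norm q (fock_embedding J F) \<le> K * G_norm q r \<alpha> F"
proof -
  let ?D = "1 / (1 - \<bar>q\<bar>)"
  have D: "?D > 0" using q by simp
  obtain r K where r: "r \<ge> 1" and K: "K > 0" "\<And>n. ?D ^ n \<le> K * (r ^ n * q_fact q n powr \<alpha>)"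
    using power_le_q_fact_powr[OF q \<alpha> D] by blast
  have main: "fock_embedding J F \<in> fock_space q \<and>
      fock_norm q (fock_embedding J F) \<le> sqrt K * G_norm q r \<alpha> F" if F: "F \<in> G_space q r \<alpha>" for F
  proof -
    define a where "a n = (norm (F n))\<^sup>2 * r ^ n * q_fact q n powr \<alpha>" for n
    define b where "b n = inner (q_operator q n (fock_embedding J F n)) (fock_embedding J F n)" for n
    have tp: "fock_embedding J F n \<in> tensor_power n" for n
      unfolding fock_embedding_def
      by (intro tensor_map_in_tensor_power[OF J_linear J_norm] G_space_tensor_power[OF F])
    have b_le: "\<bar>b n\<bar> \<le> K * a n" for n
    proof -
      have "\<bar>b n\<bar> \<le> ?D ^ n * (norm (fock_embedding J F n))\<^sup>2"
        unfolding b_def by (rule abs_q_operator_form_le[OF q tp])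
      also have "\<dots> \<le> K * (r ^ n * q_fact q n powr \<alpha>) * (norm (F n))\<^sup>2"
        unfolding fock_embedding_def using K r
        by (intro mult_mono power_mono norm_tensor_map_le[OF J_linear J_norm] G_space_tensor_power[OF F]) auto
      finally show ?thesis by (simp add: a_def mult_ac)
    qed
    have sa: "summable a" using F by (simp add: G_space_def a_def[abs_def])
    then have sKa: "summable (\<lambda>n. K * a n)" by (rule summable_mult)
    have sb: "summable b" by (rule summable_comparison_test'[OF sKa]) (use b_le in auto)
    have "suminf b \<le> (\<Sum>n. K * a n)"
      by (intro suminf_le sb sKa) (use b_le in \<open>auto simp: abs_le_iff\<close>)
    then have "suminf b \<le> K * suminf a" by (simp add: suminf_mult[OF sa])
    then have "sqrt (suminf b) \<le> sqrt (K * suminf a)" by simp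
    then have "fock_norm q (fock_embedding J F) \<le> sqrt K * G_norm q r \<alpha> F"
      by (simp add: fock_norm_def fock_inner_def G_norm_def real_sqrt_mult a_def[abs_def] b_def[abs_def])
    then show ?thesis using sb tp by (simp add: fock_space_def b_def[abs_def])
  qed
  show ?thesis by (rule that[of r "sqrt K"]) (use r K(1) main in auto)
qed

text \<open>The preimage of an open set under the embedding is already open in one of the spaces whose
  intersection is the projective limit, so it is cut out by a single generator of the topology.\<close>

lemma continuous_map_fock_embedding:
  "continuous_map (G_lim_topology q \<alpha>) (fock_topology q) (fock_embedding J)"
  unfolding continuous_map_def
proof (intro conjI allI impI)
  obtain r K where r: "r \<ge> 1" and K: "K > 0"
    and bound: "\<And>F. F \<in> G_space q r \<alpha> \<Longrightarrow>
      fock_embedding J F \<in> fock_space q \<and> fock_norm q (fock_embedding J F) \<le> K * G_norm q r \<alpha> F"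
    using fock_embedding_bounded by blast
  have openin_G_lim: "openin (G_lim_topology q \<alpha>) (G_lim q \<alpha> \<inter> V)"
    if "openin (G_topology q r \<alpha>) V" for V
    unfolding G_lim_topology_def using that r by (intro topology_generated_by_Basis) blast
  have top: "topspace (G_lim_topology q \<alpha>) = (G_lim q \<alpha> :: (nat \<Rightarrow> 'p list ell2) set)"
  proof (rule subset_antisym)
    show "topspace (G_lim_topology q \<alpha>) \<subseteq> G_lim q \<alpha>"
      unfolding G_lim_topology_def topology_generated_by_topspace by blast
    have "openin (G_topology q r \<alpha>) (G_space q r \<alpha> :: (nat \<Rightarrow> 'p list ell2) set)"
      using openin_topspace[of "G_topology q r \<alpha>"] by (simp add: G_topology_def topspace_norm_topology)
    from openin_subset[OF openin_G_lim[OF this]]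
    show "G_lim q \<alpha> \<subseteq> topspace (G_lim_topology q \<alpha> :: (nat \<Rightarrow> 'p list ell2) topology)"
      using G_lim_subset[OF r] by blast
  qed
  show "fock_embedding J \<in> topspace (G_lim_topology q \<alpha>) \<rightarrow> topspace (fock_topology q)"
    unfolding top fock_topology_def topspace_norm_topology
    using bound G_lim_subset[OF r] by blast
  fix U assume "openin (fock_topology q) (U :: (nat \<Rightarrow> 'h list ell2) set)"
  then have U: "\<And>F. F \<in> U \<Longrightarrow> \<exists>e>0. \<forall>G\<in>fock_space q. fock_norm q (\<lambda>n. F n - G n) < e \<longrightarrow> G \<in> U"
    unfolding fock_topology_def openin_norm_topology by blast
  define V where "V = {F \<in> G_space q r \<alpha>. fock_embedding J F \<in> U}"
  have "openin (G_topology q r \<alpha>) V"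
    unfolding G_topology_def openin_norm_topology
  proof (intro conjI ballI)
    show "V \<subseteq> G_space q r \<alpha>" by (auto simp: V_def)
    fix F assume "F \<in> V"
    then have F: "F \<in> G_space q r \<alpha>" "fock_embedding J F \<in> U" by (auto simp: V_def)
    from U[OF F(2)] obtain e where e: "e > 0"
      "\<And>G. G \<in> fock_space q \<Longrightarrow> fock_norm q (\<lambda>n. fock_embedding J F n - G n) < e \<Longrightarrow> G \<in> U"
      by blast
    show "\<exists>d>0. \<forall>G\<in>G_space q r \<alpha>. G_norm q r \<alpha> (\<lambda>n. F n - G n) < d \<longrightarrow> G \<in> V"
    proof (intro exI conjI ballI impI)
      show "e / K > 0" using e K by simp
      fix G assume G: "G \<in> G_space q r \<alpha>" "G_norm q r \<alpha> (\<lambda>n. F n - G n) < e / K"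
      have "fock_norm q (\<lambda>n. fock_embedding J F n - fock_embedding J G n) \<le>
          K * G_norm q r \<alpha> (\<lambda>n. F n - G n)"
        using bound[OF G_space_diff[OF _ F(1) G(1)]] r by (simp add: fock_embedding_diff)
      also have "\<dots> < e" using G(2) K by (simp add: field_simps)
      finally show "G \<in> V" using e(2) bound[OF G(1)] G(1) by (simp add: V_def)
    qed
  qed
  moreover have "{F \<in> topspace (G_lim_topology q \<alpha>). fock_embedding J F \<in> U} = G_lim q \<alpha> \<inter> V"
    using G_lim_subset[OF r] by (auto simp: top V_def)
  ultimately show "openin (G_lim_topology q \<alpha>) {F \<in> topspace (G_lim_topology q \<alpha>). fock_embedding J F \<in> U}"
    using openin_G_lim by simp
qed

lemma inj_on_fock_embedding:
  assumes "inj J"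
  shows "inj_on (fock_embedding J) (G_lim q \<alpha>)"
proof (rule inj_onI)
  fix F G assume FG: "F \<in> G_lim q \<alpha>" "G \<in> G_lim q \<alpha>" "fock_embedding J F = fock_embedding J G"
  have "F n = G n" for n
    using inj_onD[OF inj_on_tensor_map[OF J_linear J_norm assms]] G_lim_tensor_power[OF FG(1)]
      G_lim_tensor_power[OF FG(2)] fun_cong[OF FG(3), of n] by (auto simp: fock_embedding_def)
  then show "F = G" by (rule ext)
qed

text \<open>A sequence in the q-Fock space is truncated where its tail is small, and the remaining finitely
  many components are approximated in the range of the tensor powers of \<open>J\<close>.\<close>

lemma fock_embedding_dense:
  assumes dense: "closure (range J) = UNIV"
  shows "fock_topology q closure_of (fock_embedding J ` G_lim q \<alpha>) = fock_space q"
proof (intro subset_antisym subsetI)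
  fix F assume "F \<in> fock_topology q closure_of (fock_embedding J ` G_lim q \<alpha>)"
  then show "F \<in> fock_space q"
    using closure_of_subset_topspace[of "fock_topology q"]
    by (auto simp: fock_topology_def topspace_norm_topology)
next
  fix F :: "nat \<Rightarrow> 'h list ell2" assume F: "F \<in> fock_space q"
  show "F \<in> fock_topology q closure_of (fock_embedding J ` G_lim q \<alpha>)"
    unfolding in_closure_of
  proof (intro conjI allI impI)
    show "F \<in> topspace (fock_topology q)"
      using F by (simp add: fock_topology_def topspace_norm_topology)
    fix T assume "F \<in> T \<and> openin (fock_topology q) T"
    then obtain e where e: "e > 0"
      "\<And>G. G \<in> fock_space q \<Longrightarrow> fock_norm q (\<lambda>n. F n - G n) < e \<Longrightarrow> G \<in> T"
      unfolding fock_topology_def openin_norm_topology by blast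
    let ?D = "1 / (1 - \<bar>q\<bar>)" and ?Q = "\<lambda>n f. inner (q_operator q n f) f"
    have D: "?D > 0" using q by simp
    have Ft: "F n \<in> tensor_power n" for n using F by (simp add: fock_space_def)
    have sF: "summable (\<lambda>n. ?Q n (F n))" using F by (simp add: fock_space_def)
    have "e\<^sup>2 / 2 > 0" using e by simp
    then obtain N where N: "\<bar>\<Sum>n. ?Q (n + N) (F (n + N))\<bar> < e\<^sup>2 / 2"
      using suminf_exist_split[OF _ sF, of "e\<^sup>2 / 2"] by (auto simp: real_norm_def)
    \<comment> \<open>With this accuracy each of the \<open>N\<close> initial components contributes at most \<open>e\<^sup>2 / (2 (N + 1))\<close>.\<close>
    have "\<exists>f\<in>tensor_power n. norm (F n - tensor_map n J f) < sqrt (e\<^sup>2 / 2 / (Suc N) / ?D ^ n)" for n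
    proof -
      have "sqrt (e\<^sup>2 / 2 / (Suc N) / ?D ^ n) > 0" using e D by simp
      then show ?thesis
        by (rule tensor_map_approximates[OF J_linear J_norm dense Ft]) blast
    qed
    then obtain f where f: "\<And>n. f n \<in> tensor_power n"
      and near: "\<And>n. norm (F n - tensor_map n J (f n)) < sqrt (e\<^sup>2 / 2 / (Suc N) / ?D ^ n)" by metis
    define G where "G n = (if n < N then f n else 0)" for n
    have "G \<in> G_space q r \<alpha>" for r
    proof -
      have "summable (\<lambda>n. (norm (G n))\<^sup>2 * r ^ n * q_fact q n powr \<alpha>)"
        by (rule summable_finite[of "{..<N}"]) (auto simp: G_def)
      then show ?thesis
        using f by (auto simp: G_space_def G_def subspace_0[OF subspace_tensor_power])
    qed
    then have G: "G \<in> G_lim q \<alpha>" "\<And>r. G \<in> G_space q r \<alpha>" by (auto simp: G_lim_def)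
    have JG: "fock_embedding J G \<in> fock_space q"
      using fock_embedding_bounded G(2) by blast
    define d where "d n = ?Q n (F n - fock_embedding J G n)" for n
    have tail: "d n = ?Q n (F n)" if "n \<ge> N" for n
      using that by (simp add: d_def fock_embedding_def G_def linear_0[OF tensor_map_linear])
    have head: "d n \<le> e\<^sup>2 / 2 / (Suc N)" if "n < N" for n
    proof -
      have eq: "F n - fock_embedding J G n = F n - tensor_map n J (f n)"
        using that by (simp add: fock_embedding_def G_def)
      have "d n \<le> ?D ^ n * (norm (F n - tensor_map n J (f n)))\<^sup>2"
        unfolding d_def eq
        by (intro order_trans[OF abs_ge_self abs_q_operator_form_le[OF q]]
            subspace_diff[OF subspace_tensor_power] Ft tensor_map_in_tensor_power[OF J_linear J_norm] f)
      also have "\<dots> \<le> ?D ^ n * (sqrt (e\<^sup>2 / 2 / (Suc N) / ?D ^ n))\<^sup>2"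
        using D near[of n] by (intro mult_left_mono power_mono) auto
      also have "\<dots> = e\<^sup>2 / 2 / (Suc N)"
        using D by simp
      finally show ?thesis .
    qed
    have sd: "summable d"
      using sF by (rule summable_cong[THEN iffD2, rotated]) (auto simp: eventually_sequentially intro!: exI[of _ N] tail)
    have "suminf d = (\<Sum>n. d (n + N)) + (\<Sum>n<N. d n)"
      by (rule suminf_split_initial_segment[OF sd])
    also have "(\<Sum>n. d (n + N)) < e\<^sup>2 / 2"
      using N by (simp add: tail abs_less_iff)
    also have "(\<Sum>n<N. d n) \<le> (\<Sum>n<N. e\<^sup>2 / 2 / (Suc N))"
      by (rule sum_mono) (use head in auto)
    also have "\<dots> \<le> e\<^sup>2 / 2"
      using e by (simp add: field_simps)
    finally have "suminf d < e\<^sup>2" by simp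
    then have "sqrt (suminf d) < sqrt (e\<^sup>2)" by (rule real_sqrt_less_mono)
    then have "fock_norm q (\<lambda>n. F n - fock_embedding J G n) < e"
      using e by (simp add: fock_norm_def fock_inner_def d_def[abs_def])
    then show "\<exists>y. y \<in> fock_embedding J ` G_lim q \<alpha> \<and> y \<in> T"
      using e(2) JG G(1) by blast
  qed
qed

end

theorem theorem4p3:
  fixes q \<alpha> :: real
    and J :: "'p :: {real_inner, complete_space} \<Rightarrow> 'h :: {real_inner, complete_space}"
  assumes q: "q \<in> {-1<..<1}"
    and separable: "separable_space (euclidean :: 'h topology)"
    and J_linear: "linear J"
    and J_inj: "inj J"
    and J_norm: "\<And>x. norm (J x) \<le> norm x"
    and J_dense: "closure (range J) = UNIV"
    and \<alpha>: "\<alpha> \<ge> 1"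
  shows
    "(\<forall>F\<in>G_lim q \<alpha>. \<forall>G\<in>G_lim q \<alpha>.
        fock_embedding J (F \<oplus>\<^sub>s G) = fock_embedding J F \<oplus>\<^sub>s fock_embedding J G) \<and>
     (\<forall>c. \<forall>F\<in>G_lim q \<alpha>. fock_embedding J (c \<odot>\<^sub>s F) = c \<odot>\<^sub>s fock_embedding J F) \<and>
     inj_on (fock_embedding J) (G_lim q \<alpha>) \<and>
     continuous_map (G_lim_topology q \<alpha>) (fock_topology q) (fock_embedding J) \<and>
     fock_topology q closure_of (fock_embedding J ` G_lim q \<alpha>) = fock_space q \<and>
     tensor_algebra_on (G_lim q \<alpha> :: (nat \<Rightarrow> 'p list ell2) set) \<and>
     (\<forall>r s. 1 \<le> r \<and> r < s \<longrightarrow>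
        (\<exists>C\<^sub>1>0. \<forall>F\<in>G_lim q \<alpha>. \<forall>G\<in>(G_lim q \<alpha> :: (nat \<Rightarrow> 'p list ell2) set).
           G_norm q r \<alpha> (F \<otimes>\<^sub>s G) \<le> C\<^sub>1 * G_norm q s \<alpha> F * G_norm q s \<alpha> G))"
proof -
  have q1: "\<bar>q\<bar> < 1" and \<alpha>0: "\<alpha> \<ge> 0" using q \<alpha> by auto
  interpret contractive_embedding J q \<alpha>
    by unfold_locales (use J_linear J_norm q1 \<alpha>0 in \<open>auto simp: linear_add linear_scale\<close>)
  show ?thesis
  proof (intro conjI allI ballI impI)
    show "fock_embedding J (F \<oplus>\<^sub>s G) = fock_embedding J F \<oplus>\<^sub>s fock_embedding J G" for F G
      by (simp add: fock_embedding_def seq_add_def linear_add[OF tensor_map_linear])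
    show "fock_embedding J (c \<odot>\<^sub>s F) = c \<odot>\<^sub>s fock_embedding J F" for c F
      by (simp add: fock_embedding_def seq_scale_def linear_scale[OF tensor_map_linear])
    show "inj_on (fock_embedding J) (G_lim q \<alpha>)" by (rule inj_on_fock_embedding[OF J_inj])
    show "continuous_map (G_lim_topology q \<alpha>) (fock_topology q) (fock_embedding J)"
      by (rule continuous_map_fock_embedding)
    show "fock_topology q closure_of (fock_embedding J ` G_lim q \<alpha>) = fock_space q"
      by (rule fock_embedding_dense[OF J_dense])
    show "tensor_algebra_on (G_lim q \<alpha> :: (nat \<Rightarrow> 'p list ell2) set)"
      by (rule tensor_algebra_on_G_lim[OF q1 \<alpha>0])
    fix r s :: real assume rs: "1 \<le> r \<and> r < s"
    then have "0 < r" "r < s" by auto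
    then obtain C where C: "C > 0" "\<And>F G :: nat \<Rightarrow> 'p list ell2. F \<in> G_space q s \<alpha> \<Longrightarrow> G \<in> G_space q s \<alpha> \<Longrightarrow>
        F \<otimes>\<^sub>s G \<in> G_space q r \<alpha> \<and> G_norm q r \<alpha> (F \<otimes>\<^sub>s G) \<le> C * G_norm q s \<alpha> F * G_norm q s \<alpha> G"
      using G_space_seq_tensor[OF q1 \<alpha>0, where 'a = 'p] by blast
    moreover have "G_lim q \<alpha> \<subseteq> (G_space q s \<alpha> :: (nat \<Rightarrow> 'p list ell2) set)"
      using rs by (intro G_lim_subset) simp
    ultimately show "\<exists>C\<^sub>1>0. \<forall>F\<in>G_lim q \<alpha>. \<forall>G\<in>(G_lim q \<alpha> :: (nat \<Rightarrow> 'p list ell2) set).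
        G_norm q r \<alpha> (F \<otimes>\<^sub>s G) \<le> C\<^sub>1 * G_norm q s \<alpha> F * G_norm q s \<alpha> G"
      by blast
  qed
qed

end
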